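(* Let $d=1$, assume (A1), (A2), (ND) for a ground state $u_g$, and (R). Then there exists $\delta_0>0$ such that for every $u(0)\in U_{\delta_0}(u_g)\cap\mathcal S_{p+1}$ the solution of the normalized gradient flow satisfies $$\|u(t)-u_g\|_{H^1}\le Ce^{-at}\qquad\forall t>0,$$ with constants $C,a>0$ independent of $t$.
   Context: Real-valued functions; $d=1$. $\Omega\subset\mathbb R$ a bounded interval with homogeneous Dirichlet or periodic boundary conditions; $X=H^1(\Omega)$ with these conditions; $\langle\cdot,\cdot\rangle$ the $L^2$ inner product. (A1): $1<p<\infty$, $V\in L^\infty(\Omega)$, $V\ge0$. $\lambda_0:=\inf\{\frac12\|u'\|_{L^2}^2+\int_\Omega V|u|^2:u\in X,\|u\|_{L^2}=1\}$; (A2): $\omega>-\lambda_0$. $Q(u)=\frac12\|u'\|_{L^2}^2+\int_\Omega V|u|^2+\omega\|u\|_{L^2}^2$, $\mathcal A=-\frac12\partial_{xx}+V+\omega$, $\mathcal S_{p+1}=\{u\in X:\|u\|_{L^{p+1}}=1\}$. Ground state $u_g\in\arg\min\{Q(u):u\in\mathcal S_{p+1}\}$, with $\mathcal Au_g=\lambda_g|u_g|^{p-1}u_g$, $\lambda_g=Q(u_g)$; $\mathcal T_{u_g}=\{\xi\in X:\langle|u_g|^{p-1}u_g,\xi\rangle=0\}$. (ND): there is $c>0$ with $\langle\mathcal A\xi,\xi\rangle-p\lambda_g\langle|u_g|^{p-1}\xi,\xi\rangle\ge c\|\xi\|_{H^1}^2$ for all $\xi\in\mathcal T_{u_g}$.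 $U_\delta(u_g)=\{u\in X:\|u-u_g\|_{H^1}\le\delta\}$. Normalized gradient flow: $\partial_tu=-\mathcal Au+\lambda(u)|u|^{p-1}u$, $t\ge0$, with $\lambda(u)=\langle\mathcal Au,|u|^{p-1}u\rangle/\|u\|_{L^{2p}}^{2p}$; along it $\|u(t)\|_{L^{p+1}}$ is constant and $\frac{d}{dt}Q(u(t))=-2\|\partial_tu(t)\|_{L^2}^2\le0$. (R): the flow admits a unique global solution $u\in C([0,\infty);H^1(\Omega))\cap C^1((0,\infty);H^1(\Omega))$. *)

theory Defs
  imports "HOL-Analysis.Analysis"
begin

text \<open>Setting: \<Omega> = (a,b) with a < b. Functions are real-valued maps on the reals,
only their values on [a,b] matter. H^1(a,b) is realised via absolutely continuous
representatives: u has weak derivative w iff w is in L^2(a,b) and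
u x = u a + integral of w over [a,x] for all x in [a,b].\<close>

datatype bc = Dirichlet | Periodic

definition L2inner :: "real \<Rightarrow> real \<Rightarrow> (real \<Rightarrow> real) \<Rightarrow> (real \<Rightarrow> real) \<Rightarrow> real" where
  "L2inner a b f g = (LINT x:{a..b}|lborel. f x * g x)"

definition has_wderiv :: "real \<Rightarrow> real \<Rightarrow> (real \<Rightarrow> real) \<Rightarrow> (real \<Rightarrow> real) \<Rightarrow> bool" where
  "has_wderiv a b u w \<longleftrightarrow>
     set_integrable lborel {a..b} w \<and>
     set_integrable lborel {a..b} (\<lambda>x. (w x)\<^sup>2) \<and>
     (\<forall>x\<in>{a..b}. u x = u a + (LINT y:{a..x}|lborel. w y))"

definition H1 :: "real \<Rightarrow> real \<Rightarrow> (real \<Rightarrow> real) \<Rightarrow> bool" where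
  "H1 a b u \<longleftrightarrow> (\<exists>w. has_wderiv a b u w)"

definition wderiv :: "real \<Rightarrow> real \<Rightarrow> (real \<Rightarrow> real) \<Rightarrow> (real \<Rightarrow> real)" where
  "wderiv a b u = (SOME w. has_wderiv a b u w)"

definition Xsp :: "bc \<Rightarrow> real \<Rightarrow> real \<Rightarrow> (real \<Rightarrow> real) \<Rightarrow> bool" where
  "Xsp c a b u \<longleftrightarrow> H1 a b u \<and>
     (case c of Dirichlet \<Rightarrow> u a = 0 \<and> u b = 0 | Periodic \<Rightarrow> u a = u b)"

definition H1norm :: "real \<Rightarrow> real \<Rightarrow> (real \<Rightarrow> real) \<Rightarrow> real" where
  "H1norm a b u = sqrt (L2inner a b u u + L2inner a b (wderiv a b u) (wderiv a b u))"

definition Lpnorm :: "real \<Rightarrow> real \<Rightarrow> real \<Rightarrow> (real \<Rightarrow> real) \<Rightarrow> real" where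
  "Lpnorm a b q u = (LINT x:{a..b}|lborel. \<bar>u x\<bar> powr q) powr (1 / q)"

definition npow :: "real \<Rightarrow> (real \<Rightarrow> real) \<Rightarrow> (real \<Rightarrow> real)" where
  "npow p u = (\<lambda>x. \<bar>u x\<bar> powr (p - 1) * u x)"

text \<open>The bilinear form of A = -1/2 d^2/dx^2 + V + omega: <A u, phi>.\<close>
definition Aform :: "real \<Rightarrow> real \<Rightarrow> (real \<Rightarrow> real) \<Rightarrow> real \<Rightarrow> (real \<Rightarrow> real) \<Rightarrow> (real \<Rightarrow> real) \<Rightarrow> real" where
  "Aform a b V \<omega> u \<phi> = 1/2 * L2inner a b (wderiv a b u) (wderiv a b \<phi>)
      + L2inner a b (\<lambda>x. V x * u x) \<phi> + \<omega> * L2inner a b u \<phi>"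

definition Qen :: "real \<Rightarrow> real \<Rightarrow> (real \<Rightarrow> real) \<Rightarrow> real \<Rightarrow> (real \<Rightarrow> real) \<Rightarrow> real" where
  "Qen a b V \<omega> u = 1/2 * L2inner a b (wderiv a b u) (wderiv a b u)
      + (LINT x:{a..b}|lborel. V x * (u x)\<^sup>2) + \<omega> * L2inner a b u u"

definition lambda0 :: "bc \<Rightarrow> real \<Rightarrow> real \<Rightarrow> (real \<Rightarrow> real) \<Rightarrow> real" where
  "lambda0 c a b V = Inf {1/2 * L2inner a b (wderiv a b u) (wderiv a b u)
      + (LINT x:{a..b}|lborel. V x * (u x)\<^sup>2) | u. Xsp c a b u \<and> L2inner a b u u = 1}"

definition Ssph :: "bc \<Rightarrow> real \<Rightarrow> real \<Rightarrow> real \<Rightarrow> (real \<Rightarrow> real) \<Rightarrow> bool" where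
  "Ssph c a b p u \<longleftrightarrow> Xsp c a b u \<and> Lpnorm a b (p + 1) u = 1"

definition ground_state :: "bc \<Rightarrow> real \<Rightarrow> real \<Rightarrow> (real \<Rightarrow> real) \<Rightarrow> real \<Rightarrow> real \<Rightarrow> (real \<Rightarrow> real) \<Rightarrow> bool" where
  "ground_state c a b V \<omega> p ug \<longleftrightarrow> Ssph c a b p ug \<and>
     (\<forall>u. Ssph c a b p u \<longrightarrow> Qen a b V \<omega> ug \<le> Qen a b V \<omega> u)"

definition lam :: "real \<Rightarrow> real \<Rightarrow> (real \<Rightarrow> real) \<Rightarrow> real \<Rightarrow> real \<Rightarrow> (real \<Rightarrow> real) \<Rightarrow> real" where
  "lam a b V \<omega> p u = Aform a b V \<omega> u (npow p u) / (LINT x:{a..b}|lborel. \<bar>u x\<bar> powr (2 * p))"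

definition ND :: "bc \<Rightarrow> real \<Rightarrow> real \<Rightarrow> (real \<Rightarrow> real) \<Rightarrow> real \<Rightarrow> real \<Rightarrow> (real \<Rightarrow> real) \<Rightarrow> bool" where
  "ND c a b V \<omega> p ug \<longleftrightarrow> (\<exists>k>0. \<forall>\<xi>. Xsp c a b \<xi> \<and> L2inner a b (npow p ug) \<xi> = 0 \<longrightarrow>
      Aform a b V \<omega> \<xi> \<xi> - p * Qen a b V \<omega> ug * L2inner a b (\<lambda>x. \<bar>ug x\<bar> powr (p - 1) * \<xi> x) \<xi>
        \<ge> k * (H1norm a b \<xi>)\<^sup>2)"

text \<open>Solutions of the normalized gradient flow, u in C([0,inf);X) and C^1((0,inf);X),
with the equation u_t = -A u + lambda(u)|u|^{p-1}u holding in the weak (tested with X) sense.\<close>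
definition flow_sol :: "bc \<Rightarrow> real \<Rightarrow> real \<Rightarrow> (real \<Rightarrow> real) \<Rightarrow> real \<Rightarrow> real \<Rightarrow> (real \<Rightarrow> real \<Rightarrow> real) \<Rightarrow> bool" where
  "flow_sol c a b V \<omega> p u \<longleftrightarrow>
     (\<forall>t\<ge>0. Xsp c a b (u t)) \<and>
     (\<forall>t\<ge>0. ((\<lambda>s. H1norm a b (\<lambda>x. u s x - u t x)) \<longlongrightarrow> 0) (at t within {0..})) \<and>
     (\<exists>ut. (\<forall>t>0. Xsp c a b (ut t)) \<and>
        (\<forall>t>0. ((\<lambda>s. H1norm a b (\<lambda>x. (u s x - u t x) / (s - t) - ut t x)) \<longlongrightarrow> 0) (at t)) \<and>
        (\<forall>t>0. ((\<lambda>s. H1norm a b (\<lambda>x. ut s x - ut t x)) \<longlongrightarrow> 0) (at t)) \<and>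
        (\<forall>t>0. \<forall>\<phi>. Xsp c a b \<phi> \<longrightarrow>
            L2inner a b (ut t) \<phi> = - Aform a b V \<omega> (u t) \<phi>
               + lam a b V \<omega> p (u t) * L2inner a b (npow p (u t)) \<phi>))"

end

(*
  Let E = Q(u) - Q(ug) and v = u - ug.  On the constraint sphere the first-order terms of E cancel
  by the Euler-Lagrange equation, so a second-order Taylor expansion of the constraint gives
  E = B(v) + o(|v|^2), where B(v) = <A v, v> - p Q(ug) <|ug|^(p-1) v, v> is coercive up to higher
  order by (ND).  Testing the flow equation with phi = v - <|u|^(p-1) u, v> u, which is orthogonal to
  the nonlinearity and thus insensitive to the multiplier lambda(u), gives
  -<u_t, phi> = <A u, phi> = B(v) + o(|v|^2) as well, hence the gradient inequality
  |u_t|^2 >= alpha E near ug.  The energy identity E' = -2 |u_t|^2 then traps the solution near ug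
  and yields exponential decay of E, which controls |v|^2.
*)
theory Submission
  imports Defs
begin

section \<open>Square-integrable functions and abstract bilinear forms\<close>

text \<open>Every remainder is of the form e * |v|^2, with e as small as wanted on a small ball; it
  stems from uniform continuity of p |s|^(p-1) on bounded intervals. Passing from these pointwise
  bounds to small H^1 norm is where d = 1 enters, by the embedding of H^1 into the bounded
  continuous functions. The linear term <|ug|^(p-1) ug, v> of the constraint is in general not zero,
  but of second order, because u and ug both lie on the sphere. Solving the expansion for it turns 2
  Q(ug) times this term into the part of B that comes from the nonlinearity. \<open>flow_sol\<close>
  contains only the weak equation. The energy identity and the conserved norm are derived from it by
  testing with u_t and with |u|^(p-1) u. The latter has to lie in X, hence the chain rule for weak
  derivatives. Since \<open>wderiv\<close> chooses among functions that agree almost everywhere, its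
  linearity is available only under integrals.\<close>

definition L2 :: "real \<Rightarrow> real \<Rightarrow> (real \<Rightarrow> real) \<Rightarrow> bool" where
  "L2 a b f \<longleftrightarrow> set_borel_measurable lborel {a..b} f \<and> set_integrable lborel {a..b} (\<lambda>x. (f x)\<^sup>2)"

lemma set_borel_measurable_mult:
  fixes f g :: "real \<Rightarrow> real"
  assumes "set_borel_measurable M A f" "set_borel_measurable M A g"
  shows "set_borel_measurable M A (\<lambda>x. f x * g x)"
proof -
  have "(\<lambda>x. indicator A x *\<^sub>R (f x * g x)) = (\<lambda>x. (indicator A x *\<^sub>R f x) * (indicator A x *\<^sub>R g x))"
    by (auto simp: indicator_def)
  with assms show ?thesis
    unfolding set_borel_measurable_def by simp
qed

lemma set_borel_measurable_lincomb:
  fixes f g :: "real \<Rightarrow> real"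
  assumes "set_borel_measurable M A f" "set_borel_measurable M A g"
  shows "set_borel_measurable M A (\<lambda>x. r * f x + s * g x)"
proof -
  have "(\<lambda>x. indicator A x *\<^sub>R (r * f x + s * g x)) = (\<lambda>x. r * (indicator A x *\<^sub>R f x) + s * (indicator A x *\<^sub>R g x))"
    by (auto simp: indicator_def)
  with assms show ?thesis
    unfolding set_borel_measurable_def by simp
qed

lemma L2_mult_integrable:
  assumes "L2 a b f" "L2 a b g"
  shows "set_integrable lborel {a..b} (\<lambda>x. f x * g x)"
proof (rule set_integrable_bound)
  show "set_integrable lborel {a..b} (\<lambda>x. (f x)\<^sup>2 + (g x)\<^sup>2)"
    using assms by (auto simp: L2_def)
  show "set_borel_measurable lborel {a..b} (\<lambda>x. f x * g x)"
    using assms by (intro set_borel_measurable_mult) (auto simp: L2_def)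
  have "\<bar>f x * g x\<bar> \<le> (f x)\<^sup>2 + (g x)\<^sup>2" for x
  proof -
    have "2 * \<bar>f x * g x\<bar> \<le> (f x)\<^sup>2 + (g x)\<^sup>2"
      using sum_squares_bound[of "\<bar>f x\<bar>" "\<bar>g x\<bar>"] by (simp add: abs_mult)
    then show ?thesis using abs_ge_zero[of "f x * g x"] by linarith
  qed
  then show "AE x in lborel. x \<in> {a..b} \<longrightarrow> norm (f x * g x) \<le> norm ((f x)\<^sup>2 + (g x)\<^sup>2)"
    by auto
qed

lemma L2_lincomb:
  assumes "L2 a b f" "L2 a b g"
  shows "L2 a b (\<lambda>x. r * f x + s * g x)"
proof -
  have "(\<lambda>x. (r * f x + s * g x)\<^sup>2) = (\<lambda>x. r\<^sup>2 * (f x)\<^sup>2 + s\<^sup>2 * (g x)\<^sup>2 + (2 * r * s) * (f x * g x))"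
    by (auto simp: power2_eq_square algebra_simps)
  moreover have "set_integrable lborel {a..b} (\<lambda>x. r\<^sup>2 * (f x)\<^sup>2 + s\<^sup>2 * (g x)\<^sup>2 + (2 * r * s) * (f x * g x))"
    using assms L2_mult_integrable[OF assms]
    by (intro set_integral_add set_integrable_mult_right) (auto simp: L2_def)
  ultimately show ?thesis
    using assms set_borel_measurable_lincomb unfolding L2_def by auto
qed

text \<open>The bound is asked for almost everywhere only, so that the potential \<open>V\<close>,
  an L^infinity function, qualifies as a multiplier.\<close>

lemma L2_bounded_mult:
  assumes "L2 a b f" "set_borel_measurable lborel {a..b} g" "AE x\<in>{a..b} in lborel. \<bar>g x\<bar> \<le> M"
  shows "L2 a b (\<lambda>x. g x * f x)"
proof -
  have m: "set_borel_measurable lborel {a..b} (\<lambda>x. g x * f x)"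
    using assms by (intro set_borel_measurable_mult) (auto simp: L2_def)
  have "set_integrable lborel {a..b} (\<lambda>x. (g x * f x)\<^sup>2)"
  proof (rule set_integrable_bound)
    show "set_integrable lborel {a..b} (\<lambda>x. M\<^sup>2 * (f x)\<^sup>2)"
      using assms by (auto simp: L2_def)
    show "set_borel_measurable lborel {a..b} (\<lambda>x. (g x * f x)\<^sup>2)"
      unfolding power2_eq_square by (intro set_borel_measurable_mult m)
    show "AE x in lborel. x \<in> {a..b} \<longrightarrow> norm ((g x * f x)\<^sup>2) \<le> norm (M\<^sup>2 * (f x)\<^sup>2)"
      using assms(3)
    proof eventually_elim
      case (elim x)
      then show ?case
        using power_mono[of "\<bar>g x\<bar>" M 2] by (auto simp: power_mult_distrib intro!: mult_right_mono)
    qed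
  qed
  with m show ?thesis by (simp add: L2_def)
qed

lemma set_integrable_continuous_Icc:
  fixes f :: "real \<Rightarrow> real"
  assumes "continuous_on {a..b} f"
  shows "set_integrable lborel {a..b} f"
  using borel_integrable_compact[OF compact_Icc assms] by (simp add: set_integrable_def)

lemma L2_continuous:
  assumes "continuous_on {a..b} f"
  shows "L2 a b f"
proof -
  have "set_integrable lborel {a..b} (\<lambda>x. (f x)\<^sup>2)"
    by (intro set_integrable_continuous_Icc continuous_intros assms)
  moreover have "set_borel_measurable lborel {a..b} f"
    using set_measurable_continuous_on[OF _ assms] unfolding set_borel_measurable_def by simp
  ultimately show ?thesis by (simp add: L2_def)
qed

lemma L2inner_commute: "L2inner a b f g = L2inner a b g f"
  by (simp add: L2inner_def mult.commute)

lemma L2inner_lincomb: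
  assumes "L2 a b f" "L2 a b g" "L2 a b h"
  shows "L2inner a b (\<lambda>x. r * f x + s * g x) h = r * L2inner a b f h + s * L2inner a b g h"
proof -
  have "L2inner a b (\<lambda>x. r * f x + s * g x) h = (LINT x:{a..b}|lborel. r * (f x * h x) + s * (g x * h x))"
    by (simp add: L2inner_def algebra_simps)
  also have "\<dots> = r * L2inner a b f h + s * L2inner a b g h"
    unfolding L2inner_def
    by (subst set_integral_add) (auto intro!: L2_mult_integrable[OF assms(1,3)] L2_mult_integrable[OF assms(2,3)])
  finally show ?thesis .
qed

lemma L2inner_nonneg: "L2inner a b f f \<ge> 0"
  unfolding L2inner_def set_lebesgue_integral_def
  by (intro integral_nonneg_AE) auto

text \<open>Serves to exchange one weak derivative for another, since these are determined only up
  to null sets.\<close>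

lemma L2inner_cong_AE:
  assumes "L2 a b f" "L2 a b f'" "L2 a b g" "AE x\<in>{a..b} in lborel. f x = f' x"
  shows "L2inner a b f g = L2inner a b f' g"
  unfolding L2inner_def set_lebesgue_integral_def
proof (rule integral_cong_AE)
  show "(\<lambda>x. indicat_real {a..b} x *\<^sub>R (f x * g x)) \<in> borel_measurable lborel"
       "(\<lambda>x. indicat_real {a..b} x *\<^sub>R (f' x * g x)) \<in> borel_measurable lborel"
    using set_borel_measurable_mult[of lborel "{a..b}" f g] set_borel_measurable_mult[of lborel "{a..b}" f' g] assms
    by (auto simp: L2_def set_borel_measurable_def)
  show "AE x in lborel. indicat_real {a..b} x *\<^sub>R (f x * g x) = indicat_real {a..b} x *\<^sub>R (f' x * g x)"
    using assms(4)
  proof eventually_elim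
    case (elim x)
    then show ?case by (cases "x \<in> {a..b}") auto
  qed
qed

lemma L2inner_cong:
  assumes "\<And>x. x \<in> {a..b} \<Longrightarrow> f x * g x = f' x * g' x"
  shows "L2inner a b f g = L2inner a b f' g'"
  unfolding L2inner_def by (rule set_lebesgue_integral_cong) (use assms in auto)

text \<open>The function space is a predicate on all real maps, not a type. Outside \<open>X\<close>
  the integrals take default values and additivity fails, so each law is restricted to
  \<open>X\<close>. Closure is stated for linear combinations because sums, differences and
  multiples are all instances of it.\<close>

locale bilinear_form =
  fixes X :: "(real \<Rightarrow> real) \<Rightarrow> bool" and B :: "(real \<Rightarrow> real) \<Rightarrow> (real \<Rightarrow> real) \<Rightarrow> real"
  assumes lincomb: "X f \<Longrightarrow> X g \<Longrightarrow> X (\<lambda>x. r * f x + s * g x)"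
    and commute: "X f \<Longrightarrow> X g \<Longrightarrow> B f g = B g f"
    and left: "X f \<Longrightarrow> X g \<Longrightarrow> X h \<Longrightarrow> B (\<lambda>x. r * f x + s * g x) h = r * B f h + s * B g h"
begin

lemma right:
  assumes "X f" "X g" "X h"
  shows "B h (\<lambda>x. r * f x + s * g x) = r * B h f + s * B h g"
  using commute[OF assms(3) lincomb[OF assms(1,2), of r s]] left[OF assms, of r s]
    commute[OF assms(3,1)] commute[OF assms(3,2)] by simp

lemma quad:
  assumes "X f" "X g"
  shows "B (\<lambda>x. r * f x + s * g x) (\<lambda>x. r * f x + s * g x) = r\<^sup>2 * B f f + 2 * r * s * B f g + s\<^sup>2 * B g g"
  using left[OF assms lincomb[OF assms, of r s], of r s]
    right[OF assms assms(1), of r s] right[OF assms assms(2), of r s] commute[OF assms]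
  by (simp add: power2_eq_square algebra_simps)

lemma subspace:
  assumes "\<And>u. Y u \<Longrightarrow> X u" "\<And>f g r s. Y f \<Longrightarrow> Y g \<Longrightarrow> Y (\<lambda>x. r * f x + s * g x)"
  shows "bilinear_form Y B"
proof
  fix f g h r s
  show "Y f \<Longrightarrow> Y g \<Longrightarrow> Y (\<lambda>x. r * f x + s * g x)" by (rule assms(2))
  show "B f g = B g f" if "Y f" "Y g"
    by (rule commute[OF that[THEN assms(1)]])
  show "B (\<lambda>x. r * f x + s * g x) h = r * B f h + s * B g h" if "Y f" "Y g" "Y h"
    by (rule left[OF that[THEN assms(1)]])
qed

end

text \<open>Assembles both the H^1 product and the form of the operator from the L^2 product, the
  derivative form and the weighted form.\<close>

lemma bilinear_form_combine:
  assumes "bilinear_form X B" "bilinear_form X B'"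
  shows "bilinear_form X (\<lambda>u v. r * B u v + s * B' u v)"
proof -
  interpret B: bilinear_form X B by fact
  interpret B': bilinear_form X B' by fact
  show ?thesis
  proof
    fix f g h p q
    show "X f \<Longrightarrow> X g \<Longrightarrow> X (\<lambda>x. p * f x + q * g x)" by (rule B.lincomb)
    show "r * B f g + s * B' f g = r * B g f + s * B' g f" if "X f" "X g"
      using B.commute[OF that] B'.commute[OF that] by simp
    show "r * B (\<lambda>x. p * f x + q * g x) h + s * B' (\<lambda>x. p * f x + q * g x) h =
        p * (r * B f h + s * B' f h) + q * (r * B g h + s * B' g h)" if "X f" "X g" "X h"
      using B.left[OF that, of p q] B'.left[OF that, of p q] by (simp add: algebra_simps)
  qed
qed

text \<open>Definiteness cannot be demanded: a function that vanishes almost everywhere on the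
  interval has product 0 with itself without being the zero map. Cauchy-Schwarz must therefore treat
  \<open>B g g = 0\<close> separately.\<close>

locale semi_inner = bilinear_form +
  assumes nonneg: "X f \<Longrightarrow> B f f \<ge> 0"
begin

lemma Cauchy_Schwarz:
  assumes "X f" "X g"
  shows "\<bar>B f g\<bar> \<le> sqrt (B f f) * sqrt (B g g)"
proof -
  have ge: "0 \<le> r\<^sup>2 * B f f + 2 * r * s * B f g + s\<^sup>2 * B g g" for r s
    using quad[OF assms, of r s] nonneg[OF lincomb[OF assms, of r s]] by simp
  have "(B f g)\<^sup>2 \<le> B f f * B g g"
  proof (cases "B g g = 0")
    case True
    \<comment> \<open>In this case the quadratic form is affine in \<open>s\<close>. With nonzero
      slope it would be unbounded below; the \<open>s\<close> used makes its value -1.\<close>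
    have "B f g = 0"
    proof (rule ccontr)
      assume "B f g \<noteq> 0"
      then have "2 * (- (B f f + 1) / (2 * B f g)) * B f g = - (B f f + 1)" by simp
      then show False
        using ge[of 1 "- (B f f + 1) / (2 * B f g)"] True by simp
    qed
    then show ?thesis using True by simp
  next
    case False
    then have "B g g > 0" using nonneg[OF assms(2)] by simp
    \<comment> \<open>The minimising combination of \<open>f\<close> and \<open>g\<close>, scaled by
      \<open>B g g\<close> to avoid a division.\<close>
    then have "0 \<le> B g g * (B f f * B g g - (B f g)\<^sup>2)"
      using ge[of "B g g" "- B f g"] by (simp add: power2_eq_square algebra_simps)
    with \<open>B g g > 0\<close> show ?thesis by (simp add: zero_le_mult_iff)
  qed
  then have "sqrt ((B f g)\<^sup>2) \<le> sqrt (B f f * B g g)" by (rule real_sqrt_le_mono)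
  then show ?thesis by (simp add: real_sqrt_mult)
qed

lemma triangle:
  assumes "X f" "X g"
  shows "sqrt (B (\<lambda>x. r * f x + s * g x) (\<lambda>x. r * f x + s * g x)) \<le> \<bar>r\<bar> * sqrt (B f f) + \<bar>s\<bar> * sqrt (B g g)"
proof (rule real_le_lsqrt)
  note [simp] = nonneg[OF assms(1)] nonneg[OF assms(2)]
  show "0 \<le> \<bar>r\<bar> * sqrt (B f f) + \<bar>s\<bar> * sqrt (B g g)" by simp
  have "r * s * B f g \<le> \<bar>r\<bar> * \<bar>s\<bar> * \<bar>B f g\<bar>"
    using abs_ge_self[of "r * s * B f g"] by (simp only: abs_mult)
  also have "\<dots> \<le> \<bar>r\<bar> * \<bar>s\<bar> * (sqrt (B f f) * sqrt (B g g))"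
    using Cauchy_Schwarz[OF assms] by (intro mult_left_mono) auto
  finally have "r\<^sup>2 * B f f + 2 * (r * s * B f g) + s\<^sup>2 * B g g
      \<le> r\<^sup>2 * B f f + 2 * (\<bar>r\<bar> * \<bar>s\<bar> * (sqrt (B f f) * sqrt (B g g))) + s\<^sup>2 * B g g"
    by linarith
  also have "\<dots> = (\<bar>r\<bar> * sqrt (B f f) + \<bar>s\<bar> * sqrt (B g g))\<^sup>2"
    by (simp add: power2_sum power_mult_distrib)
  finally show "B (\<lambda>x. r * f x + s * g x) (\<lambda>x. r * f x + s * g x) \<le> (\<bar>r\<bar> * sqrt (B f f) + \<bar>s\<bar> * sqrt (B g g))\<^sup>2"
    using quad[OF assms, of r s] by (simp add: mult.assoc)
qed

end

lemma semi_inner_L2inner: "semi_inner (L2 a b) (L2inner a b)"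
  by unfold_locales (auto intro: L2_lincomb L2inner_commute L2inner_lincomb L2inner_nonneg)

lemma L2inner_Cauchy_Schwarz:
  assumes "L2 a b f" "L2 a b g"
  shows "\<bar>L2inner a b f g\<bar> \<le> sqrt (L2inner a b f f) * sqrt (L2inner a b g g)"
  using semi_inner.Cauchy_Schwarz[OF semi_inner_L2inner, OF assms] .

text \<open>Integrability of the square does not make a function measurable; measurability comes
  from the integrability of \<open>w\<close> itself, which \<open>has_wderiv\<close>
  demands.\<close>

lemma has_wderiv_L2: "has_wderiv a b u w \<Longrightarrow> L2 a b w"
  unfolding has_wderiv_def L2_def set_integrable_def set_borel_measurable_def by auto

section \<open>Weak derivatives and the space $H^1$\<close>

lemma has_wderivD:
  assumes "has_wderiv a b u w"
  shows "set_integrable lborel {a..b} w" "set_integrable lborel {a..b} (\<lambda>x. (w x)\<^sup>2)"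
    "x \<in> {a..b} \<Longrightarrow> u x = u a + (LINT y:{a..x}|lborel. w y)"
  using assms unfolding has_wderiv_def by blast+

lemma has_wderiv_lincomb:
  assumes "has_wderiv a b u w" "has_wderiv a b v z"
  shows "has_wderiv a b (\<lambda>x. r * u x + s * v x) (\<lambda>x. r * w x + s * z x)"
  unfolding has_wderiv_def
proof (intro conjI ballI)
  show "set_integrable lborel {a..b} (\<lambda>x. r * w x + s * z x)"
    using assms[THEN has_wderivD(1)] by (intro set_integral_add set_integrable_mult_right)
  show "set_integrable lborel {a..b} (\<lambda>x. (r * w x + s * z x)\<^sup>2)"
    using L2_lincomb[OF assms[THEN has_wderiv_L2]] by (simp add: L2_def)
  fix x assume x: "x \<in> {a..b}"
  have i: "set_integrable lborel {a..x} w" "set_integrable lborel {a..x} z"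
    by (rule set_integrable_subset[OF assms(1)[THEN has_wderivD(1)]]; use x in auto)
       (rule set_integrable_subset[OF assms(2)[THEN has_wderivD(1)]]; use x in auto)
  note assms(1)[THEN has_wderivD(3), OF x] assms(2)[THEN has_wderivD(3), OF x]
  moreover have "(LINT y:{a..x}|lborel. r * w y + s * z y) = r * (LINT y:{a..x}|lborel. w y) + s * (LINT y:{a..x}|lborel. z y)"
    using i by (subst set_integral_add) auto
  ultimately show "r * u x + s * v x = r * u a + s * v a + (LINT y:{a..x}|lborel. r * w y + s * z y)"
    by (simp only: algebra_simps)
qed

text \<open>Extended by zero, \<open>w\<close> has integral 0 over every half-line. So its positive
  and negative parts are densities of two measures that agree on half-lines, hence everywhere, and
  densities are unique almost everywhere.\<close>

lemma AE_zero_if_integrals_zero: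
  fixes w :: "real \<Rightarrow> real"
  assumes w: "set_integrable lborel {a..b} w"
    and 0: "\<And>x. x \<in> {a..b} \<Longrightarrow> (LINT y:{a..x}|lborel. w y) = 0"
  shows "AE x\<in>{a..b} in lborel. w x = 0"
proof (cases "a \<le> b")
  case True
  define f where "f x = indicator {a..b} x * w x" for x
  have f: "integrable lborel f" using w by (simp add: f_def[abs_def] set_integrable_def)
  then have [measurable]: "f \<in> borel_measurable borel" by auto
  have f0: "(LINT y:{x<..}|lborel. f y) = 0" for x
  proof -
    have all: "(LINT y:{a..b}|lborel. w y) = 0" using 0[of b] True by auto
    have "(LINT y:{x<..}|lborel. f y) = (LINT y:{x<..} \<inter> {a..b}|lborel. w y)"
      unfolding set_lebesgue_integral_def f_def by (intro Bochner_Integration.integral_cong) (auto simp: indicator_def)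
    also have "\<dots> = 0"
    proof (cases "x < a")
      case True
      then have "{x<..} \<inter> {a..b} = {a..b}" by auto
      with all show ?thesis by simp
    next
      case xa: False
      show ?thesis
      proof (cases "x \<le> b")
        case True
        then have eq: "{a..b} = {a..x} \<union> ({x<..} \<inter> {a..b})" using xa by auto
        have "(LINT y:{a..b}|lborel. w y) = (LINT y:{a..x}|lborel. w y) + (LINT y:{x<..} \<inter> {a..b}|lborel. w y)"
          by (subst eq, rule set_integral_Un) (use True in \<open>auto intro!: set_integrable_subset[OF w]\<close>)
        with all 0[of x] True xa show ?thesis by simp
      next
        case False
        then have "{x<..} \<inter> {a..b} = {}" by auto
        then show ?thesis by (simp add: set_lebesgue_integral_def)
      qed
    qed
    finally show ?thesis .
  qed
  define P where "P x = max 0 (f x)" for x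
  define N where "N x = max 0 (- f x)" for x
  have PN: "integrable lborel P" "integrable lborel N" "\<And>x. P x \<ge> 0" "\<And>x. N x \<ge> 0" "\<And>x. f x = P x - N x"
    using f by (auto simp: P_def[abs_def] N_def[abs_def])
  have [measurable]: "P \<in> borel_measurable borel" "N \<in> borel_measurable borel"
    using PN(1,2) by auto
  have em: "emeasure (density lborel (\<lambda>x. ennreal (g x))) {x<..} = ennreal (LINT y:{x<..}|lborel. g y)"
    if g: "integrable lborel g" "\<And>x. g x \<ge> 0" for g and x :: real
  proof -
    have [measurable]: "g \<in> borel_measurable borel" using g(1) by auto
    have "emeasure (density lborel (\<lambda>x. ennreal (g x))) {x<..} = (\<integral>\<^sup>+y. ennreal (indicator {x<..} y *\<^sub>R g y) \<partial>lborel)"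
      by (subst emeasure_density) (auto intro!: nn_integral_cong simp: indicator_def)
    also have "\<dots> = ennreal (LINT y:{x<..}|lborel. g y)"
      unfolding set_lebesgue_integral_def
      using g by (intro nn_integral_eq_integral integrable_mult_indicator) auto
    finally show ?thesis .
  qed
  have "density lborel (\<lambda>x. ennreal (P x)) = density lborel (\<lambda>x. ennreal (N x))"
  proof (rule measure_eqI_lessThan)
    fix x
    show "emeasure (density lborel (\<lambda>x. ennreal (P x))) {x<..} < \<infinity>"
      using em[OF PN(1,3)] by simp
    have "(LINT y:{x<..}|lborel. f y) = (LINT y:{x<..}|lborel. P y) - (LINT y:{x<..}|lborel. N y)"
      unfolding PN(5)
      by (rule set_integral_diff; unfold set_integrable_def; rule integrable_mult_indicator) (use PN in auto)
    then show "emeasure (density lborel (\<lambda>x. ennreal (P x))) {x<..} = emeasure (density lborel (\<lambda>x. ennreal (N x))) {x<..}"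
      using em[OF PN(1,3)] em[OF PN(2,4)] f0 by simp
  qed auto
  then have "AE x in lborel. ennreal (P x) = ennreal (N x)"
    by (intro sigma_finite_measure.density_unique) (auto intro: sigma_finite_lborel)
  then show ?thesis
  proof eventually_elim
    case (elim x)
    then have "P x = N x" using PN(3,4) by (simp add: ennreal_inj)
    then have "f x = 0" using PN(5) by simp
    then show ?case by (auto simp: f_def)
  qed
qed auto

text \<open>The difference of the two candidates is a weak derivative of the zero function, so its
  integrals from the left end vanish.\<close>

lemma has_wderiv_unique:
  assumes "has_wderiv a b u w" "has_wderiv a b u z"
  shows "AE x\<in>{a..b} in lborel. w x = z x"
proof -
  note D = has_wderivD[OF has_wderiv_lincomb[OF assms, of 1 "-1"]]
  have "AE x\<in>{a..b} in lborel. 1 * w x + (-1) * z x = 0"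
    by (rule AE_zero_if_integrals_zero[OF D(1)]) (use D(3) in simp)
  then show ?thesis by eventually_elim auto
qed

lemma has_wderiv_wderiv: "H1 a b u \<Longrightarrow> has_wderiv a b u (wderiv a b u)"
  unfolding H1_def wderiv_def by (erule someI_ex)

lemma L2_wderiv: "H1 a b u \<Longrightarrow> L2 a b (wderiv a b u)"
  using has_wderiv_wderiv has_wderiv_L2 by blast

lemma H1_lincomb: "H1 a b u \<Longrightarrow> H1 a b v \<Longrightarrow> H1 a b (\<lambda>x. r * u x + s * v x)"
  unfolding H1_def using has_wderiv_lincomb by blast

lemma Xsp_lincomb: "Xsp c a b u \<Longrightarrow> Xsp c a b v \<Longrightarrow> Xsp c a b (\<lambda>x. r * u x + s * v x)"
  using H1_lincomb unfolding Xsp_def by (auto split: bc.splits)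

text \<open>The choice made by \<open>wderiv\<close> is not linear as a map between functions; it is
  so almost everywhere, by uniqueness of weak derivatives, and the integral sees no more than
  that.\<close>

lemma bilinear_form_wderiv: "bilinear_form (H1 a b) (\<lambda>u v. L2inner a b (wderiv a b u) (wderiv a b v))"
proof
  fix u v h r s assume H: "H1 a b u" "H1 a b v" "H1 a b h"
  have "L2inner a b (wderiv a b (\<lambda>x. r * u x + s * v x)) (wderiv a b h) =
        L2inner a b (\<lambda>x. r * wderiv a b u x + s * wderiv a b v x) (wderiv a b h)"
  proof (intro L2inner_cong_AE L2_wderiv L2_lincomb H)
    show H1: "H1 a b (\<lambda>x. r * u x + s * v x)" using H by (intro H1_lincomb)
    show "AE x\<in>{a..b} in lborel. wderiv a b (\<lambda>x. r * u x + s * v x) x = r * wderiv a b u x + s * wderiv a b v x"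
      by (rule has_wderiv_unique[OF has_wderiv_wderiv[OF H1] has_wderiv_lincomb[OF H(1,2)[THEN has_wderiv_wderiv]]])
  qed
  also have "\<dots> = r * L2inner a b (wderiv a b u) (wderiv a b h) + s * L2inner a b (wderiv a b v) (wderiv a b h)"
    by (intro L2inner_lincomb L2_wderiv H)
  finally show "L2inner a b (wderiv a b (\<lambda>x. r * u x + s * v x)) (wderiv a b h) = \<dots>" .
qed (auto intro: H1_lincomb L2inner_commute)

section \<open>Continuity and the one-dimensional Sobolev embedding\<close>

lemma set_integral_Icc_diff:
  fixes g :: "real \<Rightarrow> real"
  assumes g: "set_integrable lborel {a..b} g" and xy: "a \<le> x" "x \<le> y" "y \<le> b"
  shows "(LINT s:{a..y}|lborel. g s) - (LINT s:{a..x}|lborel. g s) = (LINT s:{x..y}|lborel. g s)"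
proof -
  have eq: "{a..y} = {a..x} \<union> {x..y}" using xy by auto
  have ne: "AE s in lborel. \<not> (s \<in> {a..x} \<and> s \<in> {x..y})"
    using AE_lborel_singleton[of x] by (rule eventually_mono) auto
  have "set_integrable lborel {a..x} g" "set_integrable lborel {x..y} g"
    by (rule set_integrable_subset[OF g]; use xy in auto)+
  then have "(LINT s:{a..y}|lborel. g s) = (LINT s:{a..x}|lborel. g s) + (LINT s:{x..y}|lborel. g s)"
    unfolding eq by (intro set_integral_Un_AE ne) auto
  then show ?thesis by simp
qed

lemma has_wderiv_increment:
  assumes "has_wderiv a b u w" "a \<le> x" "x \<le> y" "y \<le> b"
  shows "u y - u x = (LINT s:{x..y}|lborel. w s)"
proof -
  have "(LINT s:{a..y}|lborel. w s) - (LINT s:{a..x}|lborel. w s) = (LINT s:{x..y}|lborel. w s)"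
    by (rule set_integral_Icc_diff[OF has_wderivD(1)[OF assms(1)] assms(2-4)])
  moreover have "u y = u a + (LINT s:{a..y}|lborel. w s)" "u x = u a + (LINT s:{a..x}|lborel. w s)"
    by (rule has_wderivD(3)[OF assms(1)]; use assms in auto)+
  ultimately show ?thesis by linarith
qed

text \<open>Cauchy-Schwarz for \<open>w\<close> against the constant 1 on the short interval. This
  is Hoelder continuity with exponent 1/2, the source of both the continuity and the sup bound of
  H^1 functions.\<close>

lemma has_wderiv_increment_le:
  assumes "has_wderiv a b u w" "a \<le> x" "x \<le> y" "y \<le> b"
  shows "(u y - u x)\<^sup>2 \<le> (y - x) * L2inner a b w w"
proof -
  note w2 = has_wderivD(2)[OF assms(1)]
  have sub: "{x..y} \<subseteq> {a..b}" using assms by auto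
  have "L2 x y w"
    using has_wderiv_L2[OF assms(1)] sub set_borel_measurable_subset[of lborel "{a..b}" w "{x..y}"]
      set_integrable_subset[OF w2, of "{x..y}"] by (simp add: L2_def)
  moreover have "L2 x y (\<lambda>_. 1)" by (rule L2_continuous) simp
  ultimately have L: "L2 x y w" "L2 x y (\<lambda>_. 1)" .
  have "\<bar>u y - u x\<bar> = \<bar>L2inner x y (\<lambda>_. 1) w\<bar>"
    using has_wderiv_increment[OF assms] by (simp add: L2inner_def)
  also have "\<dots> \<le> sqrt (L2inner x y (\<lambda>_. 1) (\<lambda>_. 1)) * sqrt (L2inner x y w w)"
    by (rule L2inner_Cauchy_Schwarz[OF L(2,1)])
  also have "L2inner x y (\<lambda>_. 1) (\<lambda>_. 1) = y - x"
    using assms by (simp add: L2inner_def set_lebesgue_integral_def)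
  finally have "\<bar>u y - u x\<bar>\<^sup>2 \<le> (sqrt (y - x) * sqrt (L2inner x y w w))\<^sup>2"
    by (intro power_mono) auto
  then have 1: "(u y - u x)\<^sup>2 \<le> (y - x) * L2inner x y w w"
    using assms L2inner_nonneg[of x y w] by (simp add: power_mult_distrib)
  have 2: "L2inner x y w w \<le> L2inner a b w w"
    unfolding L2inner_def set_lebesgue_integral_def
  proof (rule integral_mono)
    show "integrable lborel (\<lambda>s. indicat_real {x..y} s *\<^sub>R (w s * w s))"
      using set_integrable_subset[OF w2, of "{x..y}"] sub by (simp add: set_integrable_def power2_eq_square)
    show "integrable lborel (\<lambda>s. indicat_real {a..b} s *\<^sub>R (w s * w s))"
      using w2 by (simp add: set_integrable_def power2_eq_square)
    show "indicat_real {x..y} s *\<^sub>R (w s * w s) \<le> indicat_real {a..b} s *\<^sub>R (w s * w s)" for s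
      using sub by (auto simp: indicator_def)
  qed
  have "(y - x) * L2inner x y w w \<le> (y - x) * L2inner a b w w"
    using assms 2 by (intro mult_left_mono) auto
  with 1 show ?thesis by linarith
qed

lemma has_wderiv_increment_le':
  assumes "has_wderiv a b u w" "x \<in> {a..b}" "y \<in> {a..b}"
  shows "(u y - u x)\<^sup>2 \<le> \<bar>y - x\<bar> * L2inner a b w w"
proof (cases "x \<le> y")
  case True
  then show ?thesis using has_wderiv_increment_le[OF assms(1), of x y] assms by auto
next
  case False
  then show ?thesis
    using has_wderiv_increment_le[OF assms(1), of y x] assms power2_commute[of "u y" "u x"] by simp
qed

lemma H1_continuous_on:
  assumes "H1 a b u"
  shows "continuous_on {a..b} u"
  unfolding continuous_on_iff
proof (intro ballI allI impI)
  from assms obtain w where w: "has_wderiv a b u w" by (auto simp: H1_def)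
  fix x and e :: real assume x: "x \<in> {a..b}" and e: "e > 0"
  \<comment> \<open>The added 1 allows the division by \<open>G\<close> when the weak derivative
    vanishes.\<close>
  define G where "G = L2inner a b w w + 1"
  have G: "G > 0" using L2inner_nonneg[of a b w] by (simp add: G_def)
  show "\<exists>d>0. \<forall>y\<in>{a..b}. dist y x < d \<longrightarrow> dist (u y) (u x) < e"
  proof (intro exI conjI ballI impI)
    show "e\<^sup>2 / G > 0" using e G by simp
    fix y assume y: "y \<in> {a..b}" and d: "dist y x < e\<^sup>2 / G"
    have "(u y - u x)\<^sup>2 \<le> \<bar>y - x\<bar> * G"
      using has_wderiv_increment_le'[OF w x y] by (simp add: G_def distrib_left)
    also have "\<dots> < e\<^sup>2" using d G by (simp add: dist_real_def pos_less_divide_eq)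
    finally have "\<bar>u y - u x\<bar>\<^sup>2 < e\<^sup>2" by simp
    then have "\<bar>u y - u x\<bar> < e" by (rule power2_less_imp_less) (use e in simp)
    then show "dist (u y) (u x) < e" by (simp add: dist_real_def)
  qed
qed

lemma H1_L2: "H1 a b u \<Longrightarrow> L2 a b u"
  using H1_continuous_on L2_continuous by blast

text \<open>The polar form behind \<open>H1norm\<close>: with it, the triangle inequality of the
  norm is an instance of \<open>semi_inner\<close>.\<close>

definition H1inner :: "real \<Rightarrow> real \<Rightarrow> (real \<Rightarrow> real) \<Rightarrow> (real \<Rightarrow> real) \<Rightarrow> real" where
  "H1inner a b u v = L2inner a b u v + L2inner a b (wderiv a b u) (wderiv a b v)"

lemma H1norm_eq: "H1norm a b u = sqrt (H1inner a b u u)"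
  by (simp add: H1norm_def H1inner_def)

lemma H1inner_nonneg: "H1inner a b u u \<ge> 0"
  by (simp add: H1inner_def L2inner_nonneg)

lemma semi_inner_H1inner: "semi_inner (H1 a b) (H1inner a b)"
proof -
  interpret L: semi_inner "L2 a b" "L2inner a b" by (rule semi_inner_L2inner)
  have "bilinear_form (H1 a b) (L2inner a b)"
    by (rule L.subspace) (rule H1_L2 H1_lincomb; assumption)+
  from bilinear_form_combine[OF this bilinear_form_wderiv, of 1 1]
  have "bilinear_form (H1 a b) (H1inner a b)"
    unfolding H1inner_def[abs_def] mult_1 .
  then show ?thesis
    by (intro semi_inner.intro semi_inner_axioms.intro H1inner_nonneg)
qed

lemma H1norm_nonneg: "H1norm a b u \<ge> 0"
  by (simp add: H1norm_eq H1inner_nonneg)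

lemma H1norm_sq: "(H1norm a b u)\<^sup>2 = H1inner a b u u"
  by (simp add: H1norm_eq H1inner_nonneg)

lemma H1norm_lincomb_le:
  assumes "H1 a b u" "H1 a b v"
  shows "H1norm a b (\<lambda>x. r * u x + s * v x) \<le> \<bar>r\<bar> * H1norm a b u + \<bar>s\<bar> * H1norm a b v"
  unfolding H1norm_eq by (rule semi_inner.triangle[OF semi_inner_H1inner, OF assms])

lemma H1norm_scale:
  assumes "H1 a b u"
  shows "H1norm a b (\<lambda>x. r * u x) = \<bar>r\<bar> * H1norm a b u"
  using bilinear_form.quad[OF semi_inner.axioms(1)[OF semi_inner_H1inner], OF assms assms, of r 0]
  by (simp add: H1norm_eq real_sqrt_mult)

lemma sqrt_L2inner_le_H1norm: "sqrt (L2inner a b u u) \<le> H1norm a b u"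
  unfolding H1norm_def using L2inner_nonneg by simp

lemma sqrt_wderiv_le_H1norm: "sqrt (L2inner a b (wderiv a b u) (wderiv a b u)) \<le> H1norm a b u"
  unfolding H1norm_def using L2inner_nonneg by simp

text \<open>The Hoelder estimate compares \<open>u x\<close> with \<open>u y\<close>; averaging over
  all \<open>y\<close> replaces the unknown \<open>u y\<close> by the L^2 norm. No boundary
  condition is used, and the constant depends on the interval alone, so it can be fixed before any
  function.\<close>

lemma H1_sup_bound:
  assumes "a < b"
  obtains K where "K > 0" "\<And>u x. H1 a b u \<Longrightarrow> x \<in> {a..b} \<Longrightarrow> \<bar>u x\<bar> \<le> K * H1norm a b u"
proof
  \<comment> \<open>The two summands are the coefficients that the averaging puts before the L^2
    norm of \<open>u\<close> and that of its derivative; their sum dominates each.\<close>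
  define K2 where "K2 = 2 / (b - a) + 2 * (b - a)"
  have K2: "K2 > 0" using assms by (simp add: K2_def add_pos_pos)
  then show "sqrt K2 > 0" by simp
  fix u x assume u: "H1 a b u" and x: "x \<in> {a..b}"
  define w where "w = wderiv a b u"
  have w: "has_wderiv a b u w" using has_wderiv_wderiv[OF u] by (simp add: w_def)
  define G where "G = L2inner a b w w"
  have G: "G \<ge> 0" by (simp add: G_def L2inner_nonneg)
  have pt: "(u x)\<^sup>2 \<le> 2 * (u y)\<^sup>2 + 2 * (b - a) * G" if y: "y \<in> {a..b}" for y
  proof -
    have "(u x - u y)\<^sup>2 \<le> \<bar>x - y\<bar> * G"
      unfolding G_def by (rule has_wderiv_increment_le'[OF w y x])
    also have "\<dots> \<le> (b - a) * G" using x y G by (intro mult_right_mono) auto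
    finally have "(u x - u y)\<^sup>2 \<le> (b - a) * G" .
    moreover have "(u x)\<^sup>2 \<le> 2 * (u y)\<^sup>2 + 2 * (u x - u y)\<^sup>2"
      using zero_le_power2[of "u x - 2 * u y"] by (simp add: power2_eq_square algebra_simps)
    moreover have "2 * (b - a) * G = 2 * ((b - a) * G)" by simp
    ultimately show ?thesis by linarith
  qed
  have u2: "set_integrable lborel {a..b} (\<lambda>y. (u y)\<^sup>2)" using H1_L2[OF u] by (simp add: L2_def)
  have const: "set_integrable lborel {a..b} (\<lambda>y. k)" for k :: real
    by (intro set_integrable_continuous_Icc continuous_intros)
  have constv: "(LINT y:{a..b}|lborel. k) = (b - a) * k" for k :: real
    using assms by (simp add: set_lebesgue_integral_def)
  have "(LINT y:{a..b}|lborel. (u x)\<^sup>2) \<le> (LINT y:{a..b}|lborel. 2 * (u y)\<^sup>2 + 2 * (b - a) * G)"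
    by (intro set_integral_mono set_integral_add(1) set_integrable_mult_right u2 const pt)
  also have "\<dots> = 2 * L2inner a b u u + (b - a) * (2 * (b - a) * G)"
    by (subst set_integral_add(2)[OF set_integrable_mult_right[OF u2] const])
       (simp only: set_integral_mult_right constv L2inner_def power2_eq_square)
  finally have "(b - a) * (u x)\<^sup>2 \<le> 2 * L2inner a b u u + (b - a) * (2 * (b - a) * G)"
    by (simp only: constv)
  then have "(u x)\<^sup>2 \<le> (2 * L2inner a b u u + (b - a) * (2 * (b - a) * G)) / (b - a)"
    using assms by (simp add: pos_le_divide_eq mult.commute)
  also have "\<dots> = 2 / (b - a) * L2inner a b u u + 2 * (b - a) * G"
    using assms by (simp add: add_divide_distrib)
  also have "\<dots> \<le> K2 * L2inner a b u u + K2 * G"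
    using assms G L2inner_nonneg by (intro add_mono mult_right_mono) (auto simp: K2_def)
  also have "\<dots> = (sqrt K2 * H1norm a b u)\<^sup>2"
    using K2 by (simp add: power_mult_distrib H1norm_sq H1inner_def G_def w_def distrib_left)
  finally show "\<bar>u x\<bar> \<le> sqrt K2 * H1norm a b u"
    using K2 H1norm_nonneg[of a b u] unfolding abs_le_square_iff[symmetric] by (simp add: abs_mult)
qed

section \<open>The power nonlinearity\<close>

text \<open>At 0 the difference quotient is \<open>\<bar>s\<bar> powr (p - 1)\<close> itself, which
  tends to 0 because p > 1; as \<open>0 powr (p - 1)\<close> is 0, one formula covers both cases.
  Elsewhere this is the product rule.\<close>

lemma npow_has_real_derivative:
  assumes "p > 1"
  shows "((\<lambda>s. \<bar>s\<bar> powr (p - 1) * s) has_real_derivative p * \<bar>x\<bar> powr (p - 1)) (at x)"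
proof (cases "x = 0")
  case True
  have "((\<lambda>s. \<bar>s\<bar> powr (p - 1)) \<longlongrightarrow> 0) (at 0)"
    using tendsto_powr'[of "\<lambda>s. \<bar>s\<bar>" 0 "at (0::real)" "\<lambda>_. p - 1" "p - 1"] assms
    by (auto intro!: tendsto_eq_intros)
  then show ?thesis
    unfolding has_field_derivative_iff True using assms
    by (rule_tac Lim_transform_eventually) (auto simp: eventually_at_filter)
next
  case False
  define D where "D = p * \<bar>x\<bar> powr (p - 1)"
  have *: "((\<lambda>s. \<bar>s\<bar> powr (p - 1)) has_real_derivative ((p - 1) * \<bar>x\<bar> powr (p - 2) * sgn x)) (at x)"
  proof -
    have "((\<lambda>s. \<bar>s\<bar>) has_real_derivative sgn x) (at x)"
    proof (rule has_field_derivative_transform_within)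
      show "((*) (sgn x) has_real_derivative sgn x) (at x)"
        by (rule DERIV_cmult_Id)
      show "sgn x * s = \<bar>s\<bar>" if "dist s x < \<bar>x\<bar>" for s
        using that by (cases "x > 0") (auto simp: dist_real_def sgn_if split: if_splits)
    qed (use False in auto)
    from DERIV_chain2[OF has_real_derivative_powr this, of "p - 1"] False
    show ?thesis by (simp add: algebra_simps)
  qed
  have "\<bar>x\<bar> powr (p - 2) * sgn x * x = \<bar>x\<bar> powr (p - 1)"
  proof -
    have "\<bar>x\<bar> powr (p - 1) = \<bar>x\<bar> powr (p - 2) * \<bar>x\<bar> powr 1"
      by (subst powr_add[symmetric]) simp
    moreover have "\<bar>x\<bar> powr (p - 2) * sgn x * x = \<bar>x\<bar> powr (p - 2) * \<bar>x\<bar>"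
      by (simp add: sgn_if)
    ultimately show ?thesis by simp
  qed
  then have "(p - 1) * \<bar>x\<bar> powr (p - 2) * sgn x * x + 1 * \<bar>x\<bar> powr (p - 1) = D"
    by (simp add: D_def algebra_simps)
  with DERIV_mult[OF * DERIV_ident] show ?thesis
    by (simp add: D_def mult_ac)
qed

lemma abs_powr_Suc: "\<bar>s\<bar> powr (p + 1) = (\<bar>s\<bar> powr (p - 1) * s) * s" for s :: real
proof -
  have "\<bar>s\<bar> powr (p + 1) = \<bar>s\<bar> powr (p - 1) * \<bar>s\<bar> powr 2"
    by (subst powr_add[symmetric]) (simp add: add.commute)
  also have "\<bar>s\<bar> powr 2 = s * s"
    by (cases "s = 0") (simp_all add: power2_eq_square)
  finally show ?thesis by simp
qed

lemma abs_powr_has_real_derivative: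
  assumes "p > 1"
  shows "((\<lambda>s. \<bar>s\<bar> powr (p + 1)) has_real_derivative (p + 1) * (\<bar>x\<bar> powr (p - 1) * x)) (at x)"
  unfolding abs_powr_Suc
  using DERIV_mult[OF npow_has_real_derivative[OF assms] DERIV_ident, of x]
  by (simp add: algebra_simps)

lemma continuous_on_abs_powr:
  assumes "q > 0" "continuous_on S f"
  shows "continuous_on S (\<lambda>x. \<bar>f x\<bar> powr q :: real)"
  using assms by (intro continuous_on_powr' continuous_on_rabs continuous_on_const) auto

lemma continuous_on_npow:
  assumes "p > 1" "continuous_on S u"
  shows "continuous_on S (npow p u)"
  unfolding npow_def using assms by (intro continuous_on_mult continuous_on_abs_powr) auto

text \<open>The derivative p |s|^(p-1) need not be Lipschitz, so only its uniform continuity on a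
  bounded interval is used. The second bound follows from the first, because |s|^(p+1) has
  derivative p + 1 times the nonlinearity. One \<open>d\<close> serves both, uniformly in
  \<open>s\<close>.\<close>

lemma npow_taylor:
  assumes p: "p > 1" and e: "e > (0::real)"
  obtains d where "d > 0"
    "\<And>s h. \<bar>s\<bar> \<le> M \<Longrightarrow> \<bar>h\<bar> \<le> d \<Longrightarrow>
      \<bar>\<bar>s + h\<bar> powr (p - 1) * (s + h) - \<bar>s\<bar> powr (p - 1) * s - p * \<bar>s\<bar> powr (p - 1) * h\<bar> \<le> e * \<bar>h\<bar>"
    "\<And>s h. \<bar>s\<bar> \<le> M \<Longrightarrow> \<bar>h\<bar> \<le> d \<Longrightarrow>
      \<bar>\<bar>s + h\<bar> powr (p + 1) - \<bar>s\<bar> powr (p + 1) - (p + 1) * (\<bar>s\<bar> powr (p - 1) * s) * h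
        - (p + 1) * p / 2 * (\<bar>s\<bar> powr (p - 1) * h * h)\<bar> \<le> (p + 1) * e * h\<^sup>2"
proof -
  define f where "f s = \<bar>s\<bar> powr (p - 1) * s" for s :: real
  define f' where "f' s = p * \<bar>s\<bar> powr (p - 1)" for s :: real
  define F where "F s = \<bar>s\<bar> powr (p + 1)" for s :: real
  have Df: "(f has_real_derivative f' s) (at s)" for s
    using npow_has_real_derivative[OF p] by (simp add: f_def[abs_def] f'_def)
  have DF: "(F has_real_derivative (p + 1) * f s) (at s)" for s
    using abs_powr_has_real_derivative[OF p] by (simp add: f_def F_def[abs_def])
  have "uniformly_continuous_on {- M - 1..M + 1} f'"
    unfolding f'_def using p
    by (intro compact_uniformly_continuous continuous_intros continuous_on_abs_powr) auto
  then obtain d0 where d0: "d0 > 0"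
    "\<And>s t. s \<in> {- M - 1..M + 1} \<Longrightarrow> t \<in> {- M - 1..M + 1} \<Longrightarrow> dist t s < d0 \<Longrightarrow> dist (f' t) (f' s) < e"
    unfolding uniformly_continuous_on_def using e by metis
  \<comment> \<open>The 1 keeps \<open>s + t * h\<close> in the enlarged interval of uniform
    continuity; the half gives the strict inequality that \<open>d0\<close> needs.\<close>
  define d where "d = min 1 (d0 / 2)"
  have d: "d > 0" "d \<le> 1" "d < d0" using d0(1) by (auto simp: d_def)
  have 1: "\<bar>f (s + h) - f s - f' s * h\<bar> \<le> e * \<bar>h\<bar>" if s: "\<bar>s\<bar> \<le> M" and h: "\<bar>h\<bar> \<le> d" for s h
  proof -
    define g where "g t = f (s + t * h) - t * (f' s * h)" for t
    have Dg: "(g has_real_derivative (f' (s + t * h) * h - f' s * h)) (at t)" for t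
      unfolding g_def
      by (rule derivative_eq_intros DERIV_chain2[OF Df] refl)+ simp
    have "\<exists>t>0. t < 1 \<and> g 1 - g 0 = (1 - 0) * (f' (s + t * h) * h - f' s * h)"
      by (rule MVT2) (auto intro: Dg)
    then obtain t where t: "0 < t" "t < 1" and eq: "g 1 - g 0 = (f' (s + t * h) - f' s) * h"
      by (auto simp: left_diff_distrib)
    have th: "\<bar>t * h\<bar> \<le> d" using t h mult_mono[of "\<bar>t\<bar>" 1 "\<bar>h\<bar>" d] d by (simp add: abs_mult)
    have "dist (f' (s + t * h)) (f' s) < e"
    proof (rule d0(2))
      show "s \<in> {- M - 1..M + 1}" using s by auto
      show "s + t * h \<in> {- M - 1..M + 1}" using s th d by auto
      show "dist (s + t * h) s < d0" using th d by (simp add: dist_real_def)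
    qed
    then have "\<bar>f' (s + t * h) - f' s\<bar> * \<bar>h\<bar> \<le> e * \<bar>h\<bar>"
      by (intro mult_right_mono) (auto simp: dist_real_def)
    moreover have "g 1 - g 0 = f (s + h) - f s - f' s * h" by (simp add: g_def)
    moreover have "\<bar>g 1 - g 0\<bar> = \<bar>f' (s + t * h) - f' s\<bar> * \<bar>h\<bar>" by (simp only: eq abs_mult)
    ultimately show ?thesis by simp
  qed
  have 2: "\<bar>F (s + h) - F s - (p + 1) * f s * h - (p + 1) / 2 * (f' s * h * h)\<bar> \<le> (p + 1) * e * h\<^sup>2"
    if s: "\<bar>s\<bar> \<le> M" and h: "\<bar>h\<bar> \<le> d" for s h
  proof -
    \<comment> \<open>Chosen so that its derivative is \<open>(p + 1) * h\<close> times the first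
      remainder at \<open>t * h\<close>. The mean value theorem instead of integration loses a
      factor 2, which does not matter.\<close>
    define g where "g t = F (s + t * h) - t * ((p + 1) * f s * h) - t\<^sup>2 * ((p + 1) / 2 * (f' s * h * h))" for t
    have Dg: "(g has_real_derivative ((p + 1) * h * (f (s + t * h) - f s - f' s * (t * h)))) (at t)" for t
      unfolding g_def
      by (rule derivative_eq_intros DERIV_chain2[OF DF] refl)+ (simp add: algebra_simps)
    have "\<exists>t>0. t < 1 \<and> g 1 - g 0 = (1 - 0) * ((p + 1) * h * (f (s + t * h) - f s - f' s * (t * h)))"
      by (rule MVT2) (auto intro: Dg)
    then obtain t where t: "0 < t" "t < 1" and eq: "g 1 - g 0 = (p + 1) * h * (f (s + t * h) - f s - f' s * (t * h))"
      by auto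
    have th: "\<bar>t * h\<bar> \<le> \<bar>h\<bar>" using t mult_mono[of "\<bar>t\<bar>" 1 "\<bar>h\<bar>" "\<bar>h\<bar>"] by (simp add: abs_mult)
    have "\<bar>f (s + t * h) - f s - f' s * (t * h)\<bar> \<le> e * \<bar>t * h\<bar>"
      using 1[OF s] th h by simp
    also have "\<dots> \<le> e * \<bar>h\<bar>" using th e by (intro mult_left_mono) auto
    finally have "\<bar>g 1 - g 0\<bar> \<le> (p + 1) * \<bar>h\<bar> * (e * \<bar>h\<bar>)"
      unfolding eq abs_mult using p by (intro mult_mono) auto
    moreover have "g 1 - g 0 = F (s + h) - F s - (p + 1) * f s * h - (p + 1) / 2 * (f' s * h * h)"
      by (simp add: g_def)
    moreover have "(p + 1) * \<bar>h\<bar> * (e * \<bar>h\<bar>) = (p + 1) * e * h\<^sup>2"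
      by (simp add: power2_eq_square mult_ac)
    ultimately show ?thesis by simp
  qed
  show ?thesis
  proof (rule that[OF d(1)])
    fix s h assume "\<bar>s\<bar> \<le> M" "\<bar>h\<bar> \<le> d"
    then show "\<bar>\<bar>s + h\<bar> powr (p - 1) * (s + h) - \<bar>s\<bar> powr (p - 1) * s - p * \<bar>s\<bar> powr (p - 1) * h\<bar> \<le> e * \<bar>h\<bar>"
      using 1[of s h] by (simp add: f_def f'_def)
  next
    fix s h assume "\<bar>s\<bar> \<le> M" "\<bar>h\<bar> \<le> d"
    moreover have "(p + 1) / 2 * (f' s * h * h) = (p + 1) * p / 2 * (\<bar>s\<bar> powr (p - 1) * h * h)"
      by (simp add: f'_def)
    ultimately show "\<bar>\<bar>s + h\<bar> powr (p + 1) - \<bar>s\<bar> powr (p + 1) - (p + 1) * (\<bar>s\<bar> powr (p - 1) * s) * h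
        - (p + 1) * p / 2 * (\<bar>s\<bar> powr (p - 1) * h * h)\<bar> \<le> (p + 1) * e * h\<^sup>2"
      using 2[of s h] by (simp only: f_def F_def)
  qed
qed

section \<open>The chain rule for weak derivatives\<close>

lemma chain_increments_le:
  fixes H G :: "real \<Rightarrow> real"
  assumes d: "d > 0"
    and loc: "\<And>x y. a \<le> x \<Longrightarrow> x \<le> y \<Longrightarrow> y \<le> b \<Longrightarrow> y - x \<le> d \<Longrightarrow> \<bar>H y - H x\<bar> \<le> G y - G x"
    and xy: "a \<le> x" "x \<le> y" "y \<le> b"
  shows "\<bar>H y - H x\<bar> \<le> G y - G x"
proof -
  \<comment> \<open>Cut the interval into \<open>n\<close> equal pieces of length at most
    \<open>d\<close>. The increments of \<open>G\<close> telescope exactly, so summing the local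
    bounds loses nothing.\<close>
  obtain n :: nat where n: "real n > (y - x) / d" using reals_Archimedean2 by blast
  have "(y - x) / d \<ge> 0" using d xy by simp
  with n have n0: "n > 0" by (cases n) auto
  define z where "z k = x + real k * ((y - x) / n)" for k :: nat
  have step: "z (Suc k) - z k = (y - x) / n" for k by (simp add: z_def distrib_right add_divide_distrib)
  have "(y - x) / n \<le> d" using n n0 d by (simp add: field_simps)
  have zb: "a \<le> z k" "z k \<le> y" if "k \<le> n" for k
  proof -
    have "real k * ((y - x) / n) \<le> real n * ((y - x) / n)"
      using that xy by (intro mult_right_mono) auto
    then show "z k \<le> y" using n0 by (simp add: z_def)
    have "real k * ((y - x) / n) \<ge> 0" using xy by (intro mult_nonneg_nonneg) auto
    then show "a \<le> z k" using xy unfolding z_def by linarith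
  qed
  have "\<bar>H (z k) - H x\<bar> \<le> G (z k) - G x" if "k \<le> n" for k
    using that
  proof (induction k)
    case 0
    then show ?case by (simp add: z_def)
  next
    case (Suc k)
    have "\<bar>H (z (Suc k)) - H (z k)\<bar> \<le> G (z (Suc k)) - G (z k)"
    proof (rule loc)
      show "z k \<le> z (Suc k)" using step[of k] xy divide_nonneg_nonneg[of "y - x" "real n"] by linarith
      show "z (Suc k) - z k \<le> d" using step[of k] \<open>(y - x) / n \<le> d\<close> by linarith
    qed (use zb[of k] zb[of "Suc k"] Suc.prems xy in auto)
    with Suc show ?case by linarith
  qed
  from this[of n] show ?thesis using n0 by (simp add: z_def)
qed

lemma has_wderiv_compose:
  fixes f f' u w :: "real \<Rightarrow> real"
  assumes ab: "a \<le> b" and w: "has_wderiv a b u w"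
    and Df: "\<And>s. (f has_real_derivative f' s) (at s)" and cont: "continuous_on UNIV f'"
  shows "has_wderiv a b (\<lambda>x. f (u x)) (\<lambda>x. f' (u x) * w x)"
proof -
  have cu: "continuous_on {a..b} u" using w H1_continuous_on by (auto simp: H1_def)
  have cf'u: "continuous_on {a..b} (\<lambda>x. f' (u x))"
    using continuous_on_compose2[OF cont cu] by simp
  have "compact ((\<lambda>x. f' (u x)) ` {a..b})" by (rule compact_continuous_image[OF cf'u]) simp
  then obtain M where M: "\<And>x. x \<in> {a..b} \<Longrightarrow> \<bar>f' (u x)\<bar> \<le> M"
    using compact_imp_bounded bounded_iff by (metis image_eqI real_norm_def)
  have wi: "set_integrable lborel {a..b} w" by (rule has_wderivD(1)[OF w])
  have L2: "L2 a b (\<lambda>x. f' (u x) * w x)"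
    by (rule L2_bounded_mult[OF has_wderiv_L2[OF w]]) (use L2_continuous[OF cf'u] M in \<open>auto simp: L2_def\<close>)
  have int: "set_integrable lborel {a..b} (\<lambda>x. f' (u x) * w x)"
    by (rule L2_mult_integrable[OF L2_continuous[OF cf'u] has_wderiv_L2[OF w]])
  define J where "J x = (LINT y:{a..x}|lborel. f' (u y) * w y)" for x
  define A where "A x = (LINT y:{a..x}|lborel. \<bar>w y\<bar>)" for x
  have aw: "set_integrable lborel {a..b} (\<lambda>y. \<bar>w y\<bar>)" using wi by (rule set_integrable_abs)
  note split = set_integral_Icc_diff
  define H where "H x = f (u x) - J x" for x
  \<comment> \<open>By the mean value theorem and uniform continuity of \<open>f' \<circ> u\<close>, short increments of
    \<open>H\<close> are at most \<open>e\<close> times the integral of \<open>\<bar>w\<bar>\<close>, for every \<open>e\<close>; hence \<open>H\<close> is constant.\<close>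
  have small: "\<bar>H x - H a\<bar> \<le> e * (A x - A a)" if e: "e > 0" and x: "x \<in> {a..b}" for e x
  proof -
    have "uniformly_continuous_on {a..b} (\<lambda>x. f' (u x))"
      by (rule compact_uniformly_continuous[OF cf'u]) simp
    then obtain d where d: "d > 0"
      "\<And>s t. s \<in> {a..b} \<Longrightarrow> t \<in> {a..b} \<Longrightarrow> dist t s < d \<Longrightarrow> dist (f' (u t)) (f' (u s)) < e"
      unfolding uniformly_continuous_on_def using e by metis
    have "\<bar>H x - H a\<bar> \<le> e * A x - e * A a"
    proof (rule chain_increments_le[where a = a and b = b and d = "d / 2" and G = "\<lambda>x. e * A x"])
      fix x y assume xy: "a \<le> x" "x \<le> y" "y \<le> b" "y - x \<le> d / 2"
      have sub: "{x..y} \<subseteq> {a..b}" using xy by auto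
      \<comment> \<open>\<open>u\<close> need not be differentiable. The mean value theorem is
        applied to \<open>f\<close> between the values \<open>u x\<close> and \<open>u y\<close>,
        and the intermediate value is then attained by \<open>u\<close> at some \<open>z\<close>, by
        continuity.\<close>
      have "\<exists>z\<in>{x..y}. f (u y) - f (u x) = f' (u z) * (u y - u x)"
      proof (cases "u x = u y")
        case True
        then show ?thesis using xy by auto
      next
        case False
        define m where "m = min (u x) (u y)"
        define m' where "m' = max (u x) (u y)"
        have mm: "m < m'" using False by (auto simp: m_def m'_def)
        obtain \<xi> where \<xi>: "m < \<xi>" "\<xi> < m'" "f m' - f m = (m' - m) * f' \<xi>"
          using MVT2[OF mm, of f f'] Df by auto
        have "\<exists>z. x \<le> z \<and> z \<le> y \<and> u z = \<xi>"
        proof (cases "u x \<le> u y")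
          case True
          then show ?thesis
            using IVT'[of u x \<xi> y] \<xi> xy continuous_on_subset[OF cu sub] by (auto simp: m_def m'_def)
        next
          case False
          then show ?thesis
            using IVT2'[of u y \<xi> x] \<xi> xy continuous_on_subset[OF cu sub] by (auto simp: m_def m'_def)
        qed
        then obtain z where "z \<in> {x..y}" "u z = \<xi>" by auto
        moreover have "f (u y) - f (u x) = f' \<xi> * (u y - u x)"
          using \<xi>(3) by (cases "u x \<le> u y") (auto simp: m_def m'_def algebra_simps)
        ultimately show ?thesis by auto
      qed
      then obtain z where z: "z \<in> {x..y}" "f (u y) - f (u x) = f' (u z) * (u y - u x)" by blast
      have wxy: "set_integrable lborel {x..y} w" "set_integrable lborel {x..y} (\<lambda>s. f' (u s) * w s)"
          "set_integrable lborel {x..y} (\<lambda>s. \<bar>w s\<bar>)"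
        by (rule set_integrable_subset[OF wi] set_integrable_subset[OF int] set_integrable_subset[OF aw]; use sub in auto)+
      have "H y - H x = f' (u z) * (u y - u x) - (J y - J x)"
        using z(2) by (simp add: H_def)
      also have "J y - J x = (LINT s:{x..y}|lborel. f' (u s) * w s)"
        unfolding J_def by (rule split[OF int]) (use xy in auto)
      also have "u y - u x = (LINT s:{x..y}|lborel. w s)"
        by (rule has_wderiv_increment[OF w]) (use xy in auto)
      also have "f' (u z) * (LINT s:{x..y}|lborel. w s) - (LINT s:{x..y}|lborel. f' (u s) * w s)
          = (LINT s:{x..y}|lborel. f' (u z) * w s - f' (u s) * w s)"
        by (subst set_integral_diff(2)[OF set_integrable_mult_right[OF wxy(1)] wxy(2)]) simp
      finally have "\<bar>H y - H x\<bar> = \<bar>LINT s:{x..y}|lborel. f' (u z) * w s - f' (u s) * w s\<bar>" by simp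
      also have "\<dots> \<le> (LINT s:{x..y}|lborel. \<bar>f' (u z) * w s - f' (u s) * w s\<bar>)"
        using set_integral_diff(1)[OF set_integrable_mult_right[OF wxy(1)] wxy(2), of "f' (u z)"]
        using integral_abs_bound[of lborel "\<lambda>s. indicat_real {x..y} s *\<^sub>R (f' (u z) * w s - f' (u s) * w s)"]
        by (simp add: set_lebesgue_integral_def abs_mult)
      also have "\<dots> \<le> (LINT s:{x..y}|lborel. e * \<bar>w s\<bar>)"
      proof (rule set_integral_mono)
        show "set_integrable lborel {x..y} (\<lambda>s. \<bar>f' (u z) * w s - f' (u s) * w s\<bar>)"
          by (intro set_integrable_abs set_integral_diff(1) set_integrable_mult_right wxy)
        show "set_integrable lborel {x..y} (\<lambda>s. e * \<bar>w s\<bar>)"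
          by (intro set_integrable_mult_right wxy)
        fix s assume s: "s \<in> {x..y}"
        have "dist (f' (u z)) (f' (u s)) < e"
        proof (rule d(2))
          have "dist z s \<le> y - x" using z(1) s by (auto simp: dist_real_def abs_le_iff)
          then show "dist z s < d" using xy(4) d(1) by linarith
        qed (use s z(1) sub in auto)
        then have "\<bar>f' (u z) - f' (u s)\<bar> * \<bar>w s\<bar> \<le> e * \<bar>w s\<bar>"
          by (intro mult_right_mono) (auto simp: dist_real_def)
        then show "\<bar>f' (u z) * w s - f' (u s) * w s\<bar> \<le> e * \<bar>w s\<bar>"
          by (simp add: abs_mult[symmetric] left_diff_distrib)
      qed
      also have "\<dots> = e * (LINT s:{x..y}|lborel. \<bar>w s\<bar>)" by simp
      also have "(LINT s:{x..y}|lborel. \<bar>w s\<bar>) = A y - A x"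
        unfolding A_def by (rule split[OF aw, symmetric]) (use xy in auto)
      finally show "\<bar>H y - H x\<bar> \<le> e * A y - e * A x" by (simp add: right_diff_distrib)
    qed (use d x in auto)
    then show ?thesis by (simp add: right_diff_distrib)
  qed
  have Heq: "H x = H a" if x: "x \<in> {a..b}" for x
  proof (rule ccontr)
    assume "H x \<noteq> H a"
    then have pos: "\<bar>H x - H a\<bar> > 0" by simp
    then have "A x - A a > 0"
      using small[of 1, OF _ x] by auto
    then show False
    proof -
      \<comment> \<open>This choice of \<open>e\<close> makes the bound in \<open>small\<close> half
        of the quantity that it bounds.\<close>
      have "\<bar>H x - H a\<bar> / 2 / (A x - A a) * (A x - A a) = \<bar>H x - H a\<bar> / 2"
        using \<open>A x - A a > 0\<close> by (intro nonzero_eq_divide_eq[THEN iffD1]) auto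
      with small[of "\<bar>H x - H a\<bar> / 2 / (A x - A a)", OF _ x] pos \<open>A x - A a > 0\<close>
      show False by simp
    qed
  qed
  have Ja: "J a = 0"
  proof -
    have "J a = (LINT y:{a..a}|lborel. f' (u a) * w a)"
      unfolding J_def by (rule set_lebesgue_integral_cong) auto
    then show ?thesis by (simp add: set_lebesgue_integral_def)
  qed
  show ?thesis
    unfolding has_wderiv_def
  proof (intro conjI ballI)
    show "set_integrable lborel {a..b} (\<lambda>x. (f' (u x) * w x)\<^sup>2)" using L2 by (simp add: L2_def)
    fix x assume "x \<in> {a..b}"
    then show "f (u x) = f (u a) + (LINT y:{a..x}|lborel. f' (u y) * w y)"
      using Heq[of x] Ja by (simp add: H_def J_def)
  qed (rule int)
qed

text \<open>Makes the nonlinearity an admissible test function for the flow. Both boundary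
  conditions survive because the nonlinearity acts pointwise and vanishes at 0.\<close>

lemma Xsp_npow:
  assumes "a \<le> b" "p > 1" "Xsp c a b u"
  shows "Xsp c a b (npow p u)"
proof -
  obtain w where w: "has_wderiv a b u w" using assms by (auto simp: Xsp_def H1_def)
  have "has_wderiv a b (npow p u) (\<lambda>x. p * \<bar>u x\<bar> powr (p - 1) * w x)"
    unfolding npow_def
    by (rule has_wderiv_compose[OF assms(1) w npow_has_real_derivative[OF assms(2)]])
       (use assms in \<open>auto intro!: continuous_intros continuous_on_abs_powr\<close>)
  then show ?thesis
    using assms(3) by (auto simp: Xsp_def H1_def npow_def split: bc.splits)
qed

text \<open>\<open>wderiv\<close> depends on its function only through the predicate
  \<open>has_wderiv\<close>, which sees only values on the interval; equal predicates get the same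
  choice.\<close>

lemma H1norm_cong:
  assumes "a \<le> b" "\<And>x. x \<in> {a..b} \<Longrightarrow> f x = g x"
  shows "H1norm a b f = H1norm a b g"
proof -
  have "has_wderiv a b f = has_wderiv a b g"
    using assms unfolding has_wderiv_def by (intro ext) auto
  then have "wderiv a b f = wderiv a b g" by (simp add: wderiv_def)
  moreover have "L2inner a b f f = L2inner a b g g"
    by (rule L2inner_cong) (use assms in auto)
  ultimately show ?thesis by (simp add: H1norm_def)
qed

lemma H1_diff: "H1 a b u \<Longrightarrow> H1 a b v \<Longrightarrow> H1 a b (\<lambda>x. u x - v x)"
  using H1_lincomb[of a b u v 1 "-1"] by simp

lemma H1norm_diff_le:
  assumes "H1 a b u" "H1 a b v"
  shows "H1norm a b u \<le> H1norm a b v + H1norm a b (\<lambda>x. u x - v x)"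
  using H1norm_lincomb_le[OF assms(2) H1_diff[OF assms], of 1 1] by simp

lemma Xsp_H1: "Xsp c a b u \<Longrightarrow> H1 a b u"
  by (simp add: Xsp_def)

section \<open>Weighted forms and the expansion of the constraint\<close>

definition weighted :: "real \<Rightarrow> real \<Rightarrow> (real \<Rightarrow> real) \<Rightarrow> (real \<Rightarrow> real) \<Rightarrow> (real \<Rightarrow> real) \<Rightarrow> real" where
  "weighted a b g u v = L2inner a b (\<lambda>x. g x * u x) v"

text \<open>Used with weight \<open>V\<close> for the potential part of the operator, and with
  weight |ug|^(p-1) for the linearised nonlinearity.\<close>

lemma weighted_bilinear:
  assumes "set_borel_measurable lborel {a..b} g" "AE x\<in>{a..b} in lborel. \<bar>g x\<bar> \<le> M"
  shows "bilinear_form (H1 a b) (weighted a b g)"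
proof
  fix f h k r s
  show "H1 a b f \<Longrightarrow> H1 a b h \<Longrightarrow> H1 a b (\<lambda>x. r * f x + s * h x)" by (rule H1_lincomb)
  show "weighted a b g f h = weighted a b g h f"
    unfolding weighted_def by (rule L2inner_cong) (simp add: mult_ac)
  assume H: "H1 a b f" "H1 a b h" "H1 a b k"
  note L = H[THEN H1_L2]
  have "weighted a b g (\<lambda>x. r * f x + s * h x) k = L2inner a b (\<lambda>x. r * (g x * f x) + s * (g x * h x)) k"
    unfolding weighted_def by (rule L2inner_cong) (simp add: algebra_simps)
  also have "\<dots> = r * weighted a b g f k + s * weighted a b g h k"
    unfolding weighted_def
    by (rule L2inner_lincomb[OF L2_bounded_mult[OF L(1) assms] L2_bounded_mult[OF L(2) assms] L(3)])
  finally show "weighted a b g (\<lambda>x. r * f x + s * h x) k = r * weighted a b g f k + s * weighted a b g h k" .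
qed

lemma weighted_bound:
  assumes g: "set_borel_measurable lborel {a..b} g" "AE x\<in>{a..b} in lborel. \<bar>g x\<bar> \<le> M"
    and H: "H1 a b u" "H1 a b v"
  shows "\<bar>weighted a b g u v\<bar> \<le> \<bar>M\<bar> * H1norm a b u * H1norm a b v"
proof -
  note L = H[THEN H1_L2]
  have gu: "L2 a b (\<lambda>x. g x * u x)" by (rule L2_bounded_mult[OF L(1) g])
  have "L2inner a b (\<lambda>x. g x * u x) (\<lambda>x. g x * u x) \<le> (LINT x:{a..b}|lborel. M\<^sup>2 * (u x * u x))"
    unfolding L2inner_def
  proof (rule set_integral_mono_AE)
    show "set_integrable lborel {a..b} (\<lambda>x. g x * u x * (g x * u x))"
      by (rule L2_mult_integrable[OF gu gu])
    show "set_integrable lborel {a..b} (\<lambda>x. M\<^sup>2 * (u x * u x))"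
      by (intro set_integrable_mult_right L2_mult_integrable L)
    show "AE x\<in>{a..b} in lborel. g x * u x * (g x * u x) \<le> M\<^sup>2 * (u x * u x)"
      using g(2)
    proof eventually_elim
      case (elim x)
      show ?case
      proof
        assume "x \<in> {a..b}"
        with elim have "\<bar>g x\<bar>\<^sup>2 \<le> M\<^sup>2" by (intro power_mono) auto
        then have "(g x)\<^sup>2 * (u x * u x) \<le> M\<^sup>2 * (u x * u x)" by (intro mult_right_mono) auto
        then show "g x * u x * (g x * u x) \<le> M\<^sup>2 * (u x * u x)" by (simp add: power2_eq_square mult_ac)
      qed
    qed
  qed
  also have "\<dots> = M\<^sup>2 * L2inner a b u u" by (simp add: L2inner_def)
  finally have "sqrt (L2inner a b (\<lambda>x. g x * u x) (\<lambda>x. g x * u x)) \<le> sqrt (M\<^sup>2 * L2inner a b u u)"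
    by (rule real_sqrt_le_mono)
  also have "\<dots> = \<bar>M\<bar> * sqrt (L2inner a b u u)" by (simp add: real_sqrt_mult)
  also have "\<dots> \<le> \<bar>M\<bar> * H1norm a b u" by (intro mult_left_mono sqrt_L2inner_le_H1norm) simp
  finally have "sqrt (L2inner a b (\<lambda>x. g x * u x) (\<lambda>x. g x * u x)) * sqrt (L2inner a b v v)
      \<le> \<bar>M\<bar> * H1norm a b u * H1norm a b v"
    by (intro mult_mono sqrt_L2inner_le_H1norm) (auto simp: L2inner_nonneg H1norm_nonneg)
  with L2inner_Cauchy_Schwarz[OF gu L(2)] show ?thesis by (simp add: weighted_def)
qed

lemma set_integral_abs_le_L2inner:
  assumes "continuous_on {a..b} f" "continuous_on {a..b} h"
    and "\<And>x. x \<in> {a..b} \<Longrightarrow> \<bar>f x\<bar> \<le> k * (h x)\<^sup>2"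
  shows "\<bar>LINT x:{a..b}|lborel. f x\<bar> \<le> k * L2inner a b h h"
proof -
  note int = set_integrable_continuous_Icc
  have "\<bar>LINT x:{a..b}|lborel. f x\<bar> \<le> (LINT x:{a..b}|lborel. \<bar>f x\<bar>)"
    using integral_abs_bound[of lborel "\<lambda>x. indicat_real {a..b} x *\<^sub>R f x"]
    by (simp add: set_lebesgue_integral_def abs_mult)
  also have "\<dots> \<le> (LINT x:{a..b}|lborel. k * (h x)\<^sup>2)"
    by (rule set_integral_mono) (use assms in \<open>auto intro!: int continuous_intros\<close>)
  also have "\<dots> = k * L2inner a b h h" by (simp add: L2inner_def power2_eq_square)
  finally show ?thesis .
qed

text \<open>The constraint without its root: on the unit sphere it says the same, and its derivative
  is simpler.\<close>

definition pint :: "real \<Rightarrow> real \<Rightarrow> real \<Rightarrow> (real \<Rightarrow> real) \<Rightarrow> real" where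
  "pint a b p u = (LINT x:{a..b}|lborel. \<bar>u x\<bar> powr (p + 1))"

text \<open>The threshold \<open>d\<close> is one for the sup norm and depends on \<open>u\<close>
  only through the bound \<open>M\<close>. Both expansions share it, since the constraint and the
  tested nonlinearity are later compared for the same increment.\<close>

lemma pint_taylor:
  assumes p: "p > 1" and e: "e > 0"
  shows "\<exists>d>0. \<forall>u h. continuous_on {a..b} u \<longrightarrow> continuous_on {a..b} h \<longrightarrow>
      (\<forall>x\<in>{a..b}. \<bar>u x\<bar> \<le> M \<and> \<bar>h x\<bar> \<le> d) \<longrightarrow>
      \<bar>L2inner a b (npow p (\<lambda>x. u x + h x)) h - L2inner a b (npow p u) h
        - p * weighted a b (\<lambda>x. \<bar>u x\<bar> powr (p - 1)) h h\<bar> \<le> e * L2inner a b h h \<and>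
      \<bar>pint a b p (\<lambda>x. u x + h x) - pint a b p u - (p + 1) * L2inner a b (npow p u) h
        - (p + 1) * p / 2 * weighted a b (\<lambda>x. \<bar>u x\<bar> powr (p - 1)) h h\<bar> \<le> (p + 1) * e * L2inner a b h h"
proof -
  obtain d where d: "d > 0"
    and d1: "\<And>s h. \<bar>s\<bar> \<le> M \<Longrightarrow> \<bar>h\<bar> \<le> d \<Longrightarrow>
      \<bar>\<bar>s + h\<bar> powr (p - 1) * (s + h) - \<bar>s\<bar> powr (p - 1) * s - p * \<bar>s\<bar> powr (p - 1) * h\<bar> \<le> e * \<bar>h\<bar>"
    and d2: "\<And>s h. \<bar>s\<bar> \<le> M \<Longrightarrow> \<bar>h\<bar> \<le> d \<Longrightarrow>
      \<bar>\<bar>s + h\<bar> powr (p + 1) - \<bar>s\<bar> powr (p + 1) - (p + 1) * (\<bar>s\<bar> powr (p - 1) * s) * h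
        - (p + 1) * p / 2 * (\<bar>s\<bar> powr (p - 1) * h * h)\<bar> \<le> (p + 1) * e * h\<^sup>2"
    using npow_taylor[OF p e, of M] by metis
  note int = set_integrable_continuous_Icc
  show ?thesis
  proof (intro exI[of _ d] conjI allI impI d)
    fix u h assume cu: "continuous_on {a..b} u" and ch: "continuous_on {a..b} h"
      and uh: "\<forall>x\<in>{a..b}. \<bar>u x\<bar> \<le> M \<and> \<bar>h x\<bar> \<le> d"
    from uh have u: "\<And>x. x \<in> {a..b} \<Longrightarrow> \<bar>u x\<bar> \<le> M" and h: "\<And>x. x \<in> {a..b} \<Longrightarrow> \<bar>h x\<bar> \<le> d"
      by auto
    have cuh: "continuous_on {a..b} (\<lambda>x. u x + h x)" by (intro continuous_intros cu ch)
    have c1: "continuous_on {a..b} (\<lambda>x. npow p (\<lambda>x. u x + h x) x * h x)"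
      by (intro continuous_on_mult continuous_on_npow[OF p] cuh ch)
    have c2: "continuous_on {a..b} (\<lambda>x. npow p u x * h x)"
      by (intro continuous_on_mult continuous_on_npow[OF p] cu ch)
    have c3: "continuous_on {a..b} (\<lambda>x. \<bar>u x\<bar> powr (p - 1) * h x * h x)"
      using p by (intro continuous_on_mult continuous_on_abs_powr cu ch) auto
    have c4: "continuous_on {a..b} (\<lambda>x. \<bar>u x + h x\<bar> powr (p + 1))" "continuous_on {a..b} (\<lambda>x. \<bar>u x\<bar> powr (p + 1))"
      using p by (intro continuous_on_abs_powr cu cuh; simp)+
    have "\<bar>LINT x:{a..b}|lborel. npow p (\<lambda>x. u x + h x) x * h x - npow p u x * h x
        - p * (\<bar>u x\<bar> powr (p - 1) * h x * h x)\<bar> \<le> e * L2inner a b h h"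
    proof (rule set_integral_abs_le_L2inner)
      fix x assume x: "x \<in> {a..b}"
      let ?r = "npow p (\<lambda>x. u x + h x) x - npow p u x - p * \<bar>u x\<bar> powr (p - 1) * h x"
      have "\<bar>?r\<bar> \<le> e * \<bar>h x\<bar>"
        using d1[OF u[OF x] h[OF x]] by (simp add: npow_def)
      then have "\<bar>?r\<bar> * \<bar>h x\<bar> \<le> e * \<bar>h x\<bar> * \<bar>h x\<bar>" by (intro mult_right_mono) auto
      then show "\<bar>npow p (\<lambda>x. u x + h x) x * h x - npow p u x * h x
          - p * (\<bar>u x\<bar> powr (p - 1) * h x * h x)\<bar> \<le> e * (h x)\<^sup>2"
        by (simp add: abs_mult[symmetric] power2_eq_square left_diff_distrib mult.assoc)
    qed (intro continuous_on_diff continuous_on_mult continuous_on_const c1 c2 c3 ch)+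
    also have "(LINT x:{a..b}|lborel. npow p (\<lambda>x. u x + h x) x * h x - npow p u x * h x
        - p * (\<bar>u x\<bar> powr (p - 1) * h x * h x)) = L2inner a b (npow p (\<lambda>x. u x + h x)) h - L2inner a b (npow p u) h
        - p * weighted a b (\<lambda>x. \<bar>u x\<bar> powr (p - 1)) h h"
      unfolding L2inner_def weighted_def using int[OF c1] int[OF c2] int[OF c3]
      by simp
    finally show "\<bar>L2inner a b (npow p (\<lambda>x. u x + h x)) h - L2inner a b (npow p u) h
        - p * weighted a b (\<lambda>x. \<bar>u x\<bar> powr (p - 1)) h h\<bar> \<le> e * L2inner a b h h" .
    have "\<bar>LINT x:{a..b}|lborel. \<bar>u x + h x\<bar> powr (p + 1) - \<bar>u x\<bar> powr (p + 1) - (p + 1) * (npow p u x * h x)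
        - (p + 1) * p / 2 * (\<bar>u x\<bar> powr (p - 1) * h x * h x)\<bar> \<le> (p + 1) * e * L2inner a b h h"
    proof (rule set_integral_abs_le_L2inner)
      fix x assume x: "x \<in> {a..b}"
      show "\<bar>\<bar>u x + h x\<bar> powr (p + 1) - \<bar>u x\<bar> powr (p + 1) - (p + 1) * (npow p u x * h x)
        - (p + 1) * p / 2 * (\<bar>u x\<bar> powr (p - 1) * h x * h x)\<bar> \<le> (p + 1) * e * (h x)\<^sup>2"
        using d2[OF u[OF x] h[OF x]] by (simp add: npow_def mult.assoc)
    qed (intro continuous_on_diff continuous_on_mult continuous_on_const c1 c2 c3 c4 ch)+
    also have "(LINT x:{a..b}|lborel. \<bar>u x + h x\<bar> powr (p + 1) - \<bar>u x\<bar> powr (p + 1) - (p + 1) * (npow p u x * h x)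
        - (p + 1) * p / 2 * (\<bar>u x\<bar> powr (p - 1) * h x * h x)) =
        pint a b p (\<lambda>x. u x + h x) - pint a b p u - (p + 1) * L2inner a b (npow p u) h
        - (p + 1) * p / 2 * weighted a b (\<lambda>x. \<bar>u x\<bar> powr (p - 1)) h h"
      unfolding L2inner_def weighted_def pint_def using int[OF c2] int[OF c3] int[OF c4(1)] int[OF c4(2)]
      by simp
    finally show "\<bar>pint a b p (\<lambda>x. u x + h x) - pint a b p u - (p + 1) * L2inner a b (npow p u) h
        - (p + 1) * p / 2 * weighted a b (\<lambda>x. \<bar>u x\<bar> powr (p - 1)) h h\<bar> \<le> (p + 1) * e * L2inner a b h h" .
  qed
qed

section \<open>Differentiation of functionals along curves in $H^1$\<close>

text \<open>Frechet differentiability with a remainder of second order, which energy and constraint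
  both have. It gives continuity and a chain rule along curves without normed space types.\<close>

definition H1_diffable :: "real \<Rightarrow> real \<Rightarrow> ((real \<Rightarrow> real) \<Rightarrow> real) \<Rightarrow> (real \<Rightarrow> real) \<Rightarrow> ((real \<Rightarrow> real) \<Rightarrow> real) \<Rightarrow> bool" where
  "H1_diffable a b \<Phi> u \<l> \<longleftrightarrow>
     (\<forall>f g r s. H1 a b f \<longrightarrow> H1 a b g \<longrightarrow> \<l> (\<lambda>x. r * f x + s * g x) = r * \<l> f + s * \<l> g) \<and>
     (\<exists>C. \<forall>h. H1 a b h \<longrightarrow> \<bar>\<l> h\<bar> \<le> C * H1norm a b h) \<and>
     (\<exists>\<rho>>0. \<exists>C. \<forall>h. H1 a b h \<longrightarrow> H1norm a b h \<le> \<rho> \<longrightarrow>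
        \<bar>\<Phi> (\<lambda>x. u x + h x) - \<Phi> u - \<l> h\<bar> \<le> C * (H1norm a b h)\<^sup>2)"

lemma H1_diffableI:
  assumes "\<And>f g r s. H1 a b f \<Longrightarrow> H1 a b g \<Longrightarrow> \<l> (\<lambda>x. r * f x + s * g x) = r * \<l> f + s * \<l> g"
    and "\<And>h. H1 a b h \<Longrightarrow> \<bar>\<l> h\<bar> \<le> C1 * H1norm a b h" and "\<rho> > 0"
    and "\<And>h. H1 a b h \<Longrightarrow> H1norm a b h \<le> \<rho> \<Longrightarrow>
        \<bar>\<Phi> (\<lambda>x. u x + h x) - \<Phi> u - \<l> h\<bar> \<le> C * (H1norm a b h)\<^sup>2"
  shows "H1_diffable a b \<Phi> u \<l>"
  unfolding H1_diffable_def
proof (intro conjI)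
  show "\<exists>C. \<forall>h. H1 a b h \<longrightarrow> \<bar>\<l> h\<bar> \<le> C * H1norm a b h"
    using assms(2) by (intro exI[of _ C1]) simp
  show "\<exists>\<rho>>0. \<exists>C. \<forall>h. H1 a b h \<longrightarrow> H1norm a b h \<le> \<rho> \<longrightarrow>
        \<bar>\<Phi> (\<lambda>x. u x + h x) - \<Phi> u - \<l> h\<bar> \<le> C * (H1norm a b h)\<^sup>2"
    using assms(3,4) by (intro exI[of _ \<rho>] conjI exI[of _ C]) simp_all
qed (simp add: assms(1))

text \<open>The limit is taken within a set because at time 0 the flow is continuous from the right
  only.\<close>

lemma H1_diffable_continuous:
  assumes D: "H1_diffable a b \<Phi> (u t) \<l>"
    and u: "\<And>s. s \<in> S \<Longrightarrow> H1 a b (u s)" "t \<in> S"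
    and lim: "((\<lambda>s. H1norm a b (\<lambda>x. u s x - u t x)) \<longlongrightarrow> 0) (at t within S)"
  shows "((\<lambda>s. \<Phi> (u s)) \<longlongrightarrow> \<Phi> (u t)) (at t within S)"
proof -
  obtain C1 where C1: "\<And>h. H1 a b h \<Longrightarrow> \<bar>\<l> h\<bar> \<le> C1 * H1norm a b h"
    using D unfolding H1_diffable_def by blast
  obtain \<rho> C where \<rho>: "\<rho> > 0" and C: "\<And>h. H1 a b h \<Longrightarrow> H1norm a b h \<le> \<rho> \<Longrightarrow>
        \<bar>\<Phi> (\<lambda>x. u t x + h x) - \<Phi> (u t) - \<l> h\<bar> \<le> C * (H1norm a b h)\<^sup>2"
    using D unfolding H1_diffable_def by blast
  define n where "n s = H1norm a b (\<lambda>x. u s x - u t x)" for s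
  have n: "(n \<longlongrightarrow> 0) (at t within S)" using lim by (simp add: n_def[abs_def])
  have "((\<lambda>s. \<Phi> (u s) - \<Phi> (u t)) \<longlongrightarrow> 0) (at t within S)"
  proof (rule Lim_null_comparison)
    show "((\<lambda>s. C1 * n s + C * (n s)\<^sup>2) \<longlongrightarrow> 0) (at t within S)"
      by (auto intro!: tendsto_eq_intros n)
    have "\<forall>\<^sub>F s in at t within S. n s < \<rho>"
      by (rule order_tendstoD(2)[OF n \<rho>])
    moreover have "\<forall>\<^sub>F s in at t within S. s \<in> S" by (simp add: eventually_at_filter)
    ultimately show "\<forall>\<^sub>F s in at t within S. norm (\<Phi> (u s) - \<Phi> (u t)) \<le> C1 * n s + C * (n s)\<^sup>2"
    proof eventually_elim
      case (elim s)
      have h: "H1 a b (\<lambda>x. u s x - u t x)" by (rule H1_diff[OF u(1)[OF elim(2)] u(1)[OF u(2)]])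
      show ?case using C[OF h] C1[OF h] elim(1) by (simp add: n_def)
    qed
  qed
  then show ?thesis by (simp add: LIM_zero_iff)
qed

text \<open>Let \<open>q\<close> be the error of the difference quotient. The increment is
  \<open>(s - t)\<close> times \<open>q + z\<close>, so the linear part gives the derivative plus a
  term that vanishes with \<open>q\<close>, and the quadratic remainder divided by
  \<open>s - t\<close> is still of order \<open>s - t\<close>.\<close>

lemma H1_diffable_chain:
  assumes D: "H1_diffable a b \<Phi> (u t) \<l>"
    and u: "\<And>s. s > 0 \<Longrightarrow> H1 a b (u s)" "t > 0" and z: "H1 a b z"
    and lim: "((\<lambda>s. H1norm a b (\<lambda>x. (u s x - u t x) / (s - t) - z x)) \<longlongrightarrow> 0) (at t)"
  shows "((\<lambda>s. \<Phi> (u s)) has_real_derivative \<l> z) (at t)"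
proof -
  have lin: "\<And>f g r s. H1 a b f \<Longrightarrow> H1 a b g \<Longrightarrow> \<l> (\<lambda>x. r * f x + s * g x) = r * \<l> f + s * \<l> g"
    using D unfolding H1_diffable_def by blast
  obtain C1 where C1: "\<And>h. H1 a b h \<Longrightarrow> \<bar>\<l> h\<bar> \<le> C1 * H1norm a b h"
    using D unfolding H1_diffable_def by blast
  obtain \<rho> C where \<rho>: "\<rho> > 0" and C: "\<And>h. H1 a b h \<Longrightarrow> H1norm a b h \<le> \<rho> \<Longrightarrow>
        \<bar>\<Phi> (\<lambda>x. u t x + h x) - \<Phi> (u t) - \<l> h\<bar> \<le> C * (H1norm a b h)\<^sup>2"
    using D unfolding H1_diffable_def by blast
  define n where "n s = H1norm a b (\<lambda>x. (u s x - u t x) / (s - t) - z x)" for s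
  \<comment> \<open>A bound for the norm of the difference quotient that stays bounded as
    \<open>s\<close> tends to \<open>t\<close>.\<close>
  define m where "m s = n s + H1norm a b z" for s
  have n: "(n \<longlongrightarrow> 0) (at t)" using lim by (simp add: n_def[abs_def])
  have m: "(m \<longlongrightarrow> H1norm a b z) (at t)"
    unfolding m_def using tendsto_add[OF n tendsto_const] by simp
  have abs0: "((\<lambda>s. \<bar>s - t\<bar>) \<longlongrightarrow> 0) (at t)"
    using tendsto_rabs[OF LIM_offset_zero_cancel[of "\<lambda>s. s - t" t 0]] by (auto intro!: tendsto_eq_intros)
  have "((\<lambda>s. (\<Phi> (u s) - \<Phi> (u t)) / (s - t) - \<l> z) \<longlongrightarrow> 0) (at t)"
  proof (rule Lim_null_comparison)
    show "((\<lambda>s. C1 * n s + \<bar>C\<bar> * (\<bar>s - t\<bar> * (m s)\<^sup>2)) \<longlongrightarrow> 0) (at t)"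
      by (auto intro!: tendsto_eq_intros n m abs0)
    have "((\<lambda>s. \<bar>s - t\<bar> * m s) \<longlongrightarrow> 0) (at t)"
      by (auto intro!: tendsto_eq_intros m abs0)
    then have "\<forall>\<^sub>F s in at t. \<bar>s - t\<bar> * m s < \<rho>" by (rule order_tendstoD(2)[OF _ \<rho>])
    moreover have "\<forall>\<^sub>F s in at t. s > 0" using order_tendstoD(1)[OF tendsto_ident_at u(2)] .
    moreover have "\<forall>\<^sub>F s in at t. s \<noteq> t" by (simp add: eventually_at_filter)
    ultimately show "\<forall>\<^sub>F s in at t. norm ((\<Phi> (u s) - \<Phi> (u t)) / (s - t) - \<l> z) \<le> C1 * n s + \<bar>C\<bar> * (\<bar>s - t\<bar> * (m s)\<^sup>2)"
    proof eventually_elim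
      case (elim s)
      define h where "h x = u s x - u t x" for x
      define q where "q x = h x / (s - t) - z x" for x
      have h: "H1 a b h" unfolding h_def by (rule H1_diff[OF u(1)[OF elim(2)] u(1)[OF u(2)]])
      have q: "H1 a b q"
        using H1_lincomb[OF h z, of "1 / (s - t)" "-1"] by (simp add: q_def[abs_def])
      have hq: "h = (\<lambda>x. (s - t) * q x + (s - t) * z x)"
        using elim(3) by (auto simp: q_def field_simps)
      have nq: "H1norm a b q = n s" by (simp add: n_def q_def[abs_def] h_def)
      have "H1norm a b h \<le> \<bar>s - t\<bar> * n s + \<bar>s - t\<bar> * H1norm a b z"
        using H1norm_lincomb_le[OF q z, of "s - t" "s - t"] by (simp only: hq[symmetric] nq)
      then have hm: "H1norm a b h \<le> \<bar>s - t\<bar> * m s" by (simp add: m_def distrib_left)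
      have lh: "\<l> h = (s - t) * \<l> q + (s - t) * \<l> z"
        using lin[OF q z, of "s - t" "s - t"] by (simp only: hq[symmetric])
      have us: "(\<lambda>x. u t x + h x) = u s" by (simp add: h_def)
      have "\<bar>\<Phi> (u s) - \<Phi> (u t) - \<l> h\<bar> \<le> C * (H1norm a b h)\<^sup>2"
        using C[OF h] hm elim(1) by (simp add: us)
      also have "\<dots> \<le> \<bar>C\<bar> * (\<bar>s - t\<bar> * m s)\<^sup>2"
        using hm by (intro mult_mono power_mono) (auto simp: H1norm_nonneg)
      finally have "\<bar>\<Phi> (u s) - \<Phi> (u t) - \<l> h\<bar> / \<bar>s - t\<bar> \<le> \<bar>C\<bar> * (\<bar>s - t\<bar> * m s)\<^sup>2 / \<bar>s - t\<bar>"
        by (rule divide_right_mono) simp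
      also have "\<dots> = \<bar>C\<bar> * (\<bar>s - t\<bar> * (m s)\<^sup>2)"
        using elim(3) by (simp add: power2_eq_square)
      finally have "\<bar>(\<Phi> (u s) - \<Phi> (u t) - \<l> h) / (s - t)\<bar> \<le> \<bar>C\<bar> * (\<bar>s - t\<bar> * (m s)\<^sup>2)"
        by simp
      moreover have "(\<Phi> (u s) - \<Phi> (u t)) / (s - t) - \<l> z = (\<Phi> (u s) - \<Phi> (u t) - \<l> h) / (s - t) + \<l> q"
        using elim(3) by (simp add: lh field_simps)
      moreover have "\<bar>\<l> q\<bar> \<le> C1 * n s" using C1[OF q] by (simp only: nq)
      ultimately show ?case unfolding real_norm_def by linarith
    qed
  qed
  then show ?thesis by (simp add: has_field_derivative_iff LIM_zero_iff)
qed

section \<open>Energy, constraint and the Euler--Lagrange equation\<close>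

locale gradient_flow_setting =
  fixes c :: bc and a b p \<omega> :: real and V :: "real \<Rightarrow> real"
  assumes ab: "a < b" and p: "1 < p"
    and V_meas: "V \<in> borel_measurable lborel"
    and V_bounded: "\<exists>M. AE x\<in>{a..b} in lborel. \<bar>V x\<bar> \<le> M"
begin

abbreviation "X \<equiv> Xsp c a b"
abbreviation "nrm \<equiv> H1norm a b"
abbreviation "A \<equiv> Aform a b V \<omega>"
abbreviation "Q \<equiv> Qen a b V \<omega>"
abbreviation "ip \<equiv> L2inner a b"
abbreviation "N \<equiv> pint a b p"

lemma V_set_meas: "set_borel_measurable lborel {a..b} V"
  using V_meas unfolding set_borel_measurable_def by measurable

text \<open>The factors 1 are kept so that the right-hand side is literally a nested instance of
  \<open>bilinear_form_combine\<close>.\<close>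

lemma A_eq: "A = (\<lambda>u v. 1 * (1 / 2 * ip (wderiv a b u) (wderiv a b v) + 1 * weighted a b V u v) + \<omega> * ip u v)"
  by (intro ext) (simp add: Aform_def weighted_def)

lemma bilinear_form_L2inner_H1: "bilinear_form (H1 a b) ip"
proof -
  interpret L: semi_inner "L2 a b" "L2inner a b" by (rule semi_inner_L2inner)
  show ?thesis by (rule L.subspace) (rule H1_L2 H1_lincomb; assumption)+
qed

sublocale A: bilinear_form "H1 a b" A
proof -
  obtain M where M: "AE x\<in>{a..b} in lborel. \<bar>V x\<bar> \<le> M" using V_bounded by blast
  show "bilinear_form (H1 a b) A"
    unfolding A_eq
    by (intro bilinear_form_combine bilinear_form_wderiv bilinear_form_L2inner_H1
        weighted_bilinear[OF V_set_meas M])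
qed

lemma Q_eq_A: "Q u = A u u"
  unfolding Qen_def Aform_def L2inner_def by (simp add: power2_eq_square mult_ac)

lemma A_bound: "\<exists>C\<ge>0. \<forall>u v. H1 a b u \<longrightarrow> H1 a b v \<longrightarrow> \<bar>A u v\<bar> \<le> C * nrm u * nrm v"
proof -
  obtain M where M: "AE x\<in>{a..b} in lborel. \<bar>V x\<bar> \<le> M" using V_bounded by blast
  show ?thesis
  proof (intro exI[of _ "1 / 2 + \<bar>M\<bar> + \<bar>\<omega>\<bar>"] conjI allI impI)
    fix u v assume H: "H1 a b u" "H1 a b v"
    have "\<bar>ip (wderiv a b u) (wderiv a b v)\<bar> \<le> nrm u * nrm v"
      using L2inner_Cauchy_Schwarz[OF H[THEN L2_wderiv]]
        mult_mono[OF sqrt_wderiv_le_H1norm[of a b u] sqrt_wderiv_le_H1norm[of a b v]]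
      by (simp add: H1norm_nonneg L2inner_nonneg)
    moreover have "\<bar>ip u v\<bar> \<le> nrm u * nrm v"
      using L2inner_Cauchy_Schwarz[OF H[THEN H1_L2]]
        mult_mono[OF sqrt_L2inner_le_H1norm[of a b u] sqrt_L2inner_le_H1norm[of a b v]]
      by (simp add: H1norm_nonneg L2inner_nonneg)
    then have "\<bar>\<omega> * ip u v\<bar> \<le> \<bar>\<omega>\<bar> * (nrm u * nrm v)"
      unfolding abs_mult by (intro mult_left_mono) auto
    moreover have "\<bar>weighted a b V u v\<bar> \<le> \<bar>M\<bar> * (nrm u * nrm v)"
      using weighted_bound[OF V_set_meas M H] by (simp only: mult.assoc)
    moreover have "A u v = 1 / 2 * ip (wderiv a b u) (wderiv a b v) + weighted a b V u v + \<omega> * ip u v"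
      by (simp add: A_eq)
    ultimately have "\<bar>A u v\<bar> \<le> 1 / 2 * (nrm u * nrm v) + \<bar>M\<bar> * (nrm u * nrm v) + \<bar>\<omega>\<bar> * (nrm u * nrm v)"
      by linarith
    then show "\<bar>A u v\<bar> \<le> (1 / 2 + \<bar>M\<bar> + \<bar>\<omega>\<bar>) * nrm u * nrm v"
      by (simp add: distrib_right)
  qed simp
qed

text \<open>The energy is quadratic, so the remainder is exactly \<open>A h h\<close>.\<close>

lemma Q_diffable:
  assumes u: "H1 a b u"
  shows "H1_diffable a b Q u (\<lambda>h. 2 * A u h)"
proof -
  obtain C where C: "C \<ge> 0" "\<And>u v. H1 a b u \<Longrightarrow> H1 a b v \<Longrightarrow> \<bar>A u v\<bar> \<le> C * nrm u * nrm v"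
    using A_bound by blast
  show ?thesis
  proof (rule H1_diffableI[where \<rho> = 1])
    fix f g :: "real \<Rightarrow> real" and r s :: real assume "H1 a b f" "H1 a b g"
    then show "2 * A u (\<lambda>x. r * f x + s * g x) = r * (2 * A u f) + s * (2 * A u g)"
      using A.right[of f g u r s] u by simp
  next
    fix h assume h: "H1 a b h"
    show "\<bar>2 * A u h\<bar> \<le> 2 * C * nrm u * nrm h" using C(2)[OF u h] by simp
    have "Q (\<lambda>x. u x + h x) = Q u + 2 * A u h + A h h"
      using A.quad[OF u h, of 1 1] by (simp add: Q_eq_A)
    then show "\<bar>Q (\<lambda>x. u x + h x) - Q u - 2 * A u h\<bar> \<le> C * (nrm h)\<^sup>2"
      using C(2)[OF h h] by (simp add: power2_eq_square)
  qed simp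
qed

lemma H1_bounded:
  assumes "H1 a b u"
  obtains M where "M > 0" "\<And>x. x \<in> {a..b} \<Longrightarrow> \<bar>u x\<bar> \<le> M"
proof -
  obtain K where K: "K > 0" "\<And>u x. H1 a b u \<Longrightarrow> x \<in> {a..b} \<Longrightarrow> \<bar>u x\<bar> \<le> K * nrm u"
    using H1_sup_bound[OF ab] by blast
  show ?thesis
  proof (rule that)
    show "K * nrm u + 1 > 0" using K(1) H1norm_nonneg[of a b u] by (simp add: add_nonneg_pos)
    show "\<bar>u x\<bar> \<le> K * nrm u + 1" if "x \<in> {a..b}" for x
      using K(2)[OF assms that] by simp
  qed
qed

lemma L2_npow:
  assumes "H1 a b u" shows "L2 a b (npow p u)"
  by (rule L2_continuous[OF continuous_on_npow[OF p H1_continuous_on[OF assms]]])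

lemma ip_npow_lincomb:
  assumes "H1 a b u" "H1 a b f" "H1 a b g"
  shows "ip (npow p u) (\<lambda>x. r * f x + s * g x) = r * ip (npow p u) f + s * ip (npow p u) g"
  using L2inner_lincomb[OF H1_L2[OF assms(2)] H1_L2[OF assms(3)] L2_npow[OF assms(1)], of r s]
  by (simp only: L2inner_commute[of a b "npow p u"])

lemma weight_powr:
  assumes "H1 a b u" "\<And>x. x \<in> {a..b} \<Longrightarrow> \<bar>u x\<bar> \<le> M"
  shows "set_borel_measurable lborel {a..b} (\<lambda>x. \<bar>u x\<bar> powr (p - 1))"
    "AE x\<in>{a..b} in lborel. \<bar>\<bar>u x\<bar> powr (p - 1)\<bar> \<le> M powr (p - 1)"
proof -
  have "continuous_on {a..b} (\<lambda>x. \<bar>u x\<bar> powr (p - 1))"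
    using p by (intro continuous_on_abs_powr H1_continuous_on assms) simp
  then show "set_borel_measurable lborel {a..b} (\<lambda>x. \<bar>u x\<bar> powr (p - 1))"
    using L2_continuous by (simp add: L2_def)
  show "AE x\<in>{a..b} in lborel. \<bar>\<bar>u x\<bar> powr (p - 1)\<bar> \<le> M powr (p - 1)"
    using assms(2) p by (intro AE_I2) (auto intro!: powr_mono2)
qed

lemma L2inner_le_nrm: "ip u u \<le> (nrm u)\<^sup>2"
  by (rule sqrt_le_D[OF sqrt_L2inner_le_H1norm])

text \<open>The expansion with error factor 1 is enough: its quadratic term and its error are both
  absorbed in the remainder. The radius \<open>d / K\<close> turns small H^1 norm into small sup
  norm.\<close>

lemma N_diffable:
  assumes u: "H1 a b u"
  shows "H1_diffable a b N u (\<lambda>h. (p + 1) * ip (npow p u) h)"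
proof -
  obtain K where K: "K > 0" "\<And>u x. H1 a b u \<Longrightarrow> x \<in> {a..b} \<Longrightarrow> \<bar>u x\<bar> \<le> K * nrm u"
    using H1_sup_bound[OF ab] by blast
  obtain M where M: "M > 0" "\<And>x. x \<in> {a..b} \<Longrightarrow> \<bar>u x\<bar> \<le> M" using H1_bounded[OF u] by blast
  define w where "w = M powr (p - 1)"
  note wt = weight_powr[OF u M(2)]
  have cu: "continuous_on {a..b} u" by (rule H1_continuous_on[OF u])
  obtain d where d: "d > 0" and tay: "\<forall>u h. continuous_on {a..b} u \<longrightarrow> continuous_on {a..b} h \<longrightarrow>
      (\<forall>x\<in>{a..b}. \<bar>u x\<bar> \<le> M \<and> \<bar>h x\<bar> \<le> d) \<longrightarrow>
      \<bar>ip (npow p (\<lambda>x. u x + h x)) h - ip (npow p u) h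
        - p * weighted a b (\<lambda>x. \<bar>u x\<bar> powr (p - 1)) h h\<bar> \<le> 1 * ip h h \<and>
      \<bar>N (\<lambda>x. u x + h x) - N u - (p + 1) * ip (npow p u) h
        - (p + 1) * p / 2 * weighted a b (\<lambda>x. \<bar>u x\<bar> powr (p - 1)) h h\<bar> \<le> (p + 1) * 1 * ip h h"
    using pint_taylor[OF p zero_less_one, of a b M] by (elim exE conjE)
  define C1 where "C1 = (p + 1) * sqrt (ip (npow p u) (npow p u))"
  define C where "C = (p + 1) * p / 2 * w + (p + 1)"
  show ?thesis
  proof (rule H1_diffableI[where \<rho> = "d / K"])
    fix f g :: "real \<Rightarrow> real" and r s :: real assume "H1 a b f" "H1 a b g"
    then show "(p + 1) * ip (npow p u) (\<lambda>x. r * f x + s * g x)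
        = r * ((p + 1) * ip (npow p u) f) + s * ((p + 1) * ip (npow p u) g)"
      using ip_npow_lincomb[OF u] by (simp add: distrib_left)
  next
    fix h assume h: "H1 a b h"
    have "\<bar>ip (npow p u) h\<bar> \<le> sqrt (ip (npow p u) (npow p u)) * nrm h"
      using L2inner_Cauchy_Schwarz[OF L2_npow[OF u] H1_L2[OF h]]
        mult_left_mono[OF sqrt_L2inner_le_H1norm[of a b h], of "sqrt (ip (npow p u) (npow p u))"]
      by (simp add: L2inner_nonneg)
    then have "(p + 1) * \<bar>ip (npow p u) h\<bar> \<le> (p + 1) * (sqrt (ip (npow p u) (npow p u)) * nrm h)"
      using p by (intro mult_left_mono) auto
    then show "\<bar>(p + 1) * ip (npow p u) h\<bar> \<le> C1 * nrm h"
      using p by (simp add: C1_def abs_mult)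
    assume small: "nrm h \<le> d / K"
    have "\<bar>h x\<bar> \<le> d" if "x \<in> {a..b}" for x
      using K(2)[OF h that] mult_left_mono[OF small, of K] K(1) by simp
    with M(2) have "\<forall>x\<in>{a..b}. \<bar>u x\<bar> \<le> M \<and> \<bar>h x\<bar> \<le> d" by blast
    note t0 = tay[THEN spec, THEN spec, THEN mp, OF cu, THEN mp, OF H1_continuous_on[OF h], THEN mp, OF this, THEN conjunct2]
    have "(p + 1) * 1 * ip h h \<le> (p + 1) * (nrm h)\<^sup>2"
      using L2inner_le_nrm[of h] p by (simp add: mult_left_mono)
    with t0 have t: "\<bar>N (\<lambda>x. u x + h x) - N u - (p + 1) * ip (npow p u) h
        - (p + 1) * p / 2 * weighted a b (\<lambda>x. \<bar>u x\<bar> powr (p - 1)) h h\<bar> \<le> (p + 1) * (nrm h)\<^sup>2"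
      by (rule order_trans)
    have "\<bar>weighted a b (\<lambda>x. \<bar>u x\<bar> powr (p - 1)) h h\<bar> \<le> w * (nrm h)\<^sup>2"
      using weighted_bound[OF wt h h] by (simp add: w_def power2_eq_square)
    then have "(p + 1) * p / 2 * \<bar>weighted a b (\<lambda>x. \<bar>u x\<bar> powr (p - 1)) h h\<bar> \<le> (p + 1) * p / 2 * (w * (nrm h)\<^sup>2)"
      using p by (intro mult_left_mono) auto
    then have "\<bar>(p + 1) * p / 2 * weighted a b (\<lambda>x. \<bar>u x\<bar> powr (p - 1)) h h\<bar> \<le> (p + 1) * p / 2 * w * (nrm h)\<^sup>2"
      using p by (simp add: abs_mult)
    with t have "\<bar>N (\<lambda>x. u x + h x) - N u - (p + 1) * ip (npow p u) h\<bar> \<le> (p + 1) * p / 2 * w * (nrm h)\<^sup>2 + (p + 1) * (nrm h)\<^sup>2"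
      by linarith
    then show "\<bar>N (\<lambda>x. u x + h x) - N u - (p + 1) * ip (npow p u) h\<bar> \<le> C * (nrm h)\<^sup>2"
      by (simp only: C_def distrib_right)
  qed (use d K in simp)
qed

lemma N_nonneg: "N u \<ge> 0"
  unfolding pint_def set_lebesgue_integral_def by (intro integral_nonneg_AE) auto

lemma Ssph_iff: "Ssph c a b p u \<longleftrightarrow> X u \<and> N u = 1"
proof -
  have "Lpnorm a b (p + 1) u = N u powr (1 / (p + 1))" by (simp add: Lpnorm_def pint_def)
  moreover have "N u powr (1 / (p + 1)) = 1 \<longleftrightarrow> N u = 1"
  proof
    assume *: "N u powr (1 / (p + 1)) = 1"
    then have "(N u powr (1 / (p + 1))) powr (p + 1) = 1" by simp
    then show "N u = 1" using p N_nonneg[of u] by (simp add: powr_powr)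
  qed simp
  ultimately show ?thesis by (simp add: Ssph_def)
qed

lemma ip_npow_self: "ip (npow p u) u = N u"
  unfolding L2inner_def pint_def npow_def abs_powr_Suc by simp

lemma ip_npow_npow: "ip (npow p u) (npow p u) = (LINT x:{a..b}|lborel. \<bar>u x\<bar> powr (2 * p))"
proof -
  have "\<bar>s\<bar> powr (p - 1) * s * (\<bar>s\<bar> powr (p - 1) * s) = \<bar>s\<bar> powr (2 * p)" for s :: real
  proof -
    have "\<bar>s\<bar> powr (p - 1) * s * (\<bar>s\<bar> powr (p - 1) * s) = (\<bar>s\<bar> powr (p - 1) * \<bar>s\<bar> powr (p - 1)) * (s * s)"
      by simp
    also have "s * s = \<bar>s\<bar> powr 2"
      by (cases "s = 0") (simp_all add: power2_eq_square)
    also have "(\<bar>s\<bar> powr (p - 1) * \<bar>s\<bar> powr (p - 1)) * \<bar>s\<bar> powr 2 = \<bar>s\<bar> powr (2 * p)"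
    proof -
      have "\<bar>s\<bar> powr (2 * p) = \<bar>s\<bar> powr ((p - 1) + (p - 1) + 2)" by (simp add: algebra_simps)
      then show ?thesis by (simp only: powr_add)
    qed
    finally show ?thesis .
  qed
  then show ?thesis unfolding L2inner_def npow_def by simp
qed

text \<open>Homogeneity replaces the Lagrange multiplier rule. Rescaling to the sphere shows that
  \<open>Q u - Q ug * N u powr (2 / (p + 1))\<close> is nonnegative wherever \<open>N u > 0\<close>,
  and it is 0 at \<open>ug\<close>. Its derivative in direction \<open>\<phi>\<close> therefore
  vanishes, with multiplier \<open>Q ug\<close>.\<close>

lemma ground_state_EL:
  assumes gs: "ground_state c a b V \<omega> p ug" and \<phi>: "X \<phi>"
  shows "A ug \<phi> = Q ug * ip (npow p ug) \<phi>"
proof -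
  have ug: "X ug" "N ug = 1" and min: "\<And>u. X u \<Longrightarrow> N u = 1 \<Longrightarrow> Q ug \<le> Q u"
    using gs by (auto simp: ground_state_def Ssph_iff)
  have H: "H1 a b ug" "H1 a b \<phi>" using ug(1) \<phi> Xsp_H1 by blast+
  \<comment> \<open>The base point is \<open>s = 1\<close>, since the chain rule is stated for curves on \<open>s > 0\<close>.\<close>
  define u where "u s x = ug x + (s - 1) * \<phi> x" for s x :: real
  have Xu: "X (u s)" for s
    using Xsp_lincomb[OF ug(1) \<phi>, of 1 "s - 1"] by (simp add: u_def[abs_def])
  have u1: "u 1 = ug" by (simp add: u_def[abs_def])
  have lim: "((\<lambda>s. nrm (\<lambda>x. (u s x - u 1 x) / (s - 1) - \<phi> x)) \<longlongrightarrow> 0) (at 1)"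
  proof (rule tendsto_eventually)
    have "\<forall>\<^sub>F s in at (1::real). s \<noteq> 1" by (simp add: eventually_at_filter)
    then show "\<forall>\<^sub>F s in at 1. nrm (\<lambda>x. (u s x - u 1 x) / (s - 1) - \<phi> x) = 0"
    proof eventually_elim
      case (elim s)
      then have "(\<lambda>x. (u s x - u 1 x) / (s - 1) - \<phi> x) = (\<lambda>x. 0 * \<phi> x)"
        by (simp add: u_def)
      then show ?case using H1norm_scale[OF H(2), of 0] by simp
    qed
  qed
  have dQ: "((\<lambda>s. Q (u s)) has_real_derivative 2 * A ug \<phi>) (at 1)"
    by (rule H1_diffable_chain[where u = u and t = 1 and \<Phi> = Q and \<l> = "\<lambda>h. 2 * A ug h", OF _ Xsp_H1[OF Xu] zero_less_one H(2) lim])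
       (simp only: u1 Q_diffable[OF H(1)])
  have dN: "((\<lambda>s. N (u s)) has_real_derivative (p + 1) * ip (npow p ug) \<phi>) (at 1)"
    by (rule H1_diffable_chain[where u = u and t = 1 and \<Phi> = N and \<l> = "\<lambda>h. (p + 1) * ip (npow p ug) h", OF _ Xsp_H1[OF Xu] zero_less_one H(2) lim])
       (simp only: u1 N_diffable[OF H(1)])
  define G where "G s = Q (u s) - Q ug * N (u s) powr (2 / (p + 1))" for s
  have "((\<lambda>s. N (u s) powr (2 / (p + 1))) has_real_derivative 2 / (p + 1) * 1 * ((p + 1) * ip (npow p ug) \<phi>)) (at 1)"
    using DERIV_chain2[OF has_real_derivative_powr dN, of "2 / (p + 1)"] ug(2) u1 by simp
  then have dP: "((\<lambda>s. N (u s) powr (2 / (p + 1))) has_real_derivative 2 * ip (npow p ug) \<phi>) (at 1)"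
    using p by simp
  have dG: "(G has_real_derivative 2 * A ug \<phi> - Q ug * (2 * ip (npow p ug) \<phi>)) (at 1)"
    unfolding G_def by (intro DERIV_diff DERIV_cmult dQ dP)
  \<comment> \<open>The rescaling needs \<open>N (u s)\<close> positive, which holds near the base
    point by continuity.\<close>
  have "(\<lambda>s. N (u s)) \<midarrow>1\<rightarrow> N (u 1)"
    using DERIV_isCont[OF dN] by (simp add: isCont_def)
  then have "\<forall>\<^sub>F s in at 1. N (u s) > 0" by (rule order_tendstoD) (simp add: u1 ug)
  then obtain d where d: "d > 0" "\<And>s. s \<noteq> 1 \<Longrightarrow> dist s 1 < d \<Longrightarrow> N (u s) > 0"
    unfolding eventually_at by auto
  have "\<forall>s. \<bar>1 - s\<bar> < d \<longrightarrow> G 1 \<le> G s"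
  proof (intro allI impI)
    fix s assume s: "\<bar>1 - s\<bar> < d"
    have Ns: "N (u s) > 0"
    proof (cases "s = 1")
      case True
      then show ?thesis by (simp add: u1 ug)
    next
      case False
      then show ?thesis using s by (intro d(2)) (auto simp: dist_real_def)
    qed
    \<comment> \<open>The L^(p+1) norm of \<open>u s\<close>, by which the curve is scaled back to
      the sphere.\<close>
    define r where "r = N (u s) powr (1 / (p + 1))"
    have r: "r > 0" using Ns by (simp add: r_def)
    have rp: "r powr (p + 1) = N (u s)" using Ns p by (simp add: r_def powr_powr)
    have r2: "r\<^sup>2 = N (u s) powr (2 / (p + 1))"
      using Ns by (simp add: r_def powr_power)
    have "Q ug \<le> Q (\<lambda>x. (1 / r) * u s x)"
    proof (rule min)
      show "X (\<lambda>x. (1 / r) * u s x)"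
        using Xsp_lincomb[OF Xu[of s] Xu[of s], of "1 / r" 0] by simp
      have "\<bar>(1 / r) * y\<bar> powr (p + 1) = (1 / N (u s)) * \<bar>y\<bar> powr (p + 1)" for y
        using r by (simp add: abs_mult powr_divide rp)
      then have "N (\<lambda>x. (1 / r) * u s x) = (LINT x:{a..b}|lborel. (1 / N (u s)) * \<bar>u s x\<bar> powr (p + 1))"
        unfolding pint_def by simp
      also have "\<dots> = (1 / N (u s)) * N (u s)"
        unfolding set_integral_mult_right by (simp add: pint_def)
      finally show "N (\<lambda>x. (1 / r) * u s x) = 1" using Ns by simp
    qed
    also have "\<dots> = Q (u s) / r\<^sup>2"
      using A.quad[OF Xsp_H1[OF Xu[of s]] Xsp_H1[OF Xu[of s]], of "1 / r" 0]
      by (simp add: Q_eq_A power_divide)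
    finally have "Q ug * r\<^sup>2 \<le> Q (u s)" using r by (simp add: pos_le_divide_eq)
    then show "G 1 \<le> G s" by (simp add: G_def u1 ug r2)
  qed
  from DERIV_local_min[OF dG d(1) this] show ?thesis by simp
qed

section \<open>Local coercivity and the gradient inequality\<close>

text \<open>All constants are fixed before \<open>u\<close>, so that one ball serves a whole
  trajectory. The velocity enters only as some \<open>z\<close> that satisfies the weak equation at
  \<open>u\<close>, which keeps time out of the estimates.\<close>

lemma ground_state_local_estimates:
  assumes gs: "ground_state c a b V \<omega> p ug" and nd: "ND c a b V \<omega> p ug"
  shows "\<exists>\<delta>>0. \<exists>c1>0. \<exists>C1>0. \<exists>\<alpha>>0. \<forall>u. Ssph c a b p u \<longrightarrow> nrm (\<lambda>x. u x - ug x) \<le> \<delta> \<longrightarrow>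
      c1 * (nrm (\<lambda>x. u x - ug x))\<^sup>2 \<le> Q u - Q ug \<and>
      Q u - Q ug \<le> C1 * (nrm (\<lambda>x. u x - ug x))\<^sup>2 \<and>
      (\<forall>z \<mu>. X z \<longrightarrow> (\<forall>\<phi>. X \<phi> \<longrightarrow> ip z \<phi> = - A u \<phi> + \<mu> * ip (npow p u) \<phi>) \<longrightarrow>
        \<alpha> * (Q u - Q ug) \<le> ip z z)"
proof -
  have ug: "X ug" "N ug = 1" using gs by (auto simp: ground_state_def Ssph_iff)
  have Hg: "H1 a b ug" by (rule Xsp_H1[OF ug(1)])
  define \<Lambda> where "\<Lambda> = Q ug"
  define g where "g x = \<bar>ug x\<bar> powr (p - 1)" for x
  obtain k where k: "k > 0" "\<And>\<xi>. X \<xi> \<Longrightarrow> ip (npow p ug) \<xi> = 0 \<Longrightarrow>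
      A \<xi> \<xi> - p * \<Lambda> * weighted a b g \<xi> \<xi> \<ge> k * (nrm \<xi>)\<^sup>2"
    using nd unfolding ND_def weighted_def g_def \<Lambda>_def by blast
  obtain K where K: "K > 0" "\<And>u x. H1 a b u \<Longrightarrow> x \<in> {a..b} \<Longrightarrow> \<bar>u x\<bar> \<le> K * nrm u"
    using H1_sup_bound[OF ab] by blast
  obtain M where M: "M > 0" "\<And>x. x \<in> {a..b} \<Longrightarrow> \<bar>ug x\<bar> \<le> M" using H1_bounded[OF Hg] by blast
  note wt = weight_powr[OF Hg M(2), folded g_def]
  interpret W: bilinear_form "H1 a b" "weighted a b g"
    by (rule weighted_bilinear[OF wt])
  obtain CA where CA: "CA \<ge> 0" "\<And>u v. H1 a b u \<Longrightarrow> H1 a b v \<Longrightarrow> \<bar>A u v\<bar> \<le> CA * nrm u * nrm v"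
    using A_bound by blast
  define w where "w = M powr (p - 1)"
  define G where "G = nrm ug"
  define L where "L = \<bar>\<Lambda>\<bar> + 1"
  \<comment> \<open>The budget for the coercivity constant: projecting onto the tangent space leaves
    k/2 - k/8 = 3k/8, and two further losses of k/16 leave k/4. With this \<open>\<epsilon>\<close>,
    a Taylor remainder times \<open>\<Lambda>\<close> costs at most k/16.\<close>
  define \<epsilon> where "\<epsilon> = min 1 (k / (16 * L))"
  have w: "w > 0" and G: "G \<ge> 0" and L: "L > 0" "\<bar>\<Lambda>\<bar> \<le> L"
    using M(1) by (auto simp: w_def G_def L_def H1norm_nonneg)
  have \<epsilon>: "\<epsilon> > 0" "\<epsilon> \<le> 1" "L * \<epsilon> \<le> k / 16"
  proof -
    show "\<epsilon> > 0" "\<epsilon> \<le> 1" using k(1) L by (auto simp: \<epsilon>_def)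
    have "L * \<epsilon> \<le> L * (k / (16 * L))" using L by (intro mult_left_mono) (auto simp: \<epsilon>_def)
    then show "L * \<epsilon> \<le> k / 16" using L by simp
  qed
  obtain d where d: "d > 0" and tay: "\<forall>u h. continuous_on {a..b} u \<longrightarrow> continuous_on {a..b} h \<longrightarrow>
      (\<forall>x\<in>{a..b}. \<bar>u x\<bar> \<le> M \<and> \<bar>h x\<bar> \<le> d) \<longrightarrow>
      \<bar>ip (npow p (\<lambda>x. u x + h x)) h - ip (npow p u) h
        - p * weighted a b (\<lambda>x. \<bar>u x\<bar> powr (p - 1)) h h\<bar> \<le> \<epsilon> * ip h h \<and>
      \<bar>N (\<lambda>x. u x + h x) - N u - (p + 1) * ip (npow p u) h
        - (p + 1) * p / 2 * weighted a b (\<lambda>x. \<bar>u x\<bar> powr (p - 1)) h h\<bar> \<le> (p + 1) * \<epsilon> * ip h h"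
    using pint_taylor[OF p \<epsilon>(1), of a b M] by (elim exE conjE)
  \<comment> \<open>With n the norm of v = u - ug: \<open>m\<close> and \<open>m'\<close> bound
    <|ug|^(p-1) ug, v> and <|u|^(p-1) u, v> by multiples of n^2, \<open>C1\<close> bounds the energy
    gap likewise, \<open>S\<close> collects the n^4 terms of the projection, and
    \<open>P * n\<close> bounds the test function.\<close>
  define m where "m = p * w / 2 + 1"
  define m' where "m' = m + p * w + 1"
  define C1 where "C1 = 2 * L * m + CA"
  define S where "S = (k * G\<^sup>2 + (p - 1) * L) * m\<^sup>2"
  define P where "P = 1 + m' * (G + 1)"
  \<comment> \<open>The test gives k/4 n^2 \<le> P n |z|, hence |z| \<ge> k n / (4 P); the energy
    gap is at most C1 n^2.\<close>
  define \<alpha> where "\<alpha> = (k / 4)\<^sup>2 / (P\<^sup>2 * C1)"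
  \<comment> \<open>\<open>d / K\<close> puts v below the Taylor threshold in the sup norm. Since
    n^4 \<le> \<delta> n^2 for n \<le> \<delta> \<le> 1, the last two entries shrink the n^4 terms
    to k/8 n^2 and k/16 n^2.\<close>
  define \<delta> where "\<delta> = min (min 1 (d / K)) (min (k / (8 * (S + 1))) (k / (16 * (m' * C1 + 1))))"
  have m: "m \<ge> 1" using p w by (simp add: m_def)
  have m': "m' \<ge> 1" using p w m by (simp add: m'_def)
  have C1: "C1 > 0" using L m CA(1) by (simp add: C1_def add_pos_nonneg)
  have S: "S \<ge> 0" using k(1) p L by (simp add: S_def)
  have P: "P > 0" using m' G by (simp add: P_def add_pos_nonneg)
  have \<alpha>: "\<alpha> > 0" using k(1) P C1 by (simp add: \<alpha>_def)
  have m'C1: "m' * C1 \<ge> 0" using m' C1 by simp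
  have \<delta>: "\<delta> > 0" "\<delta> \<le> 1" "\<delta> \<le> d / K" "\<delta> * S \<le> k / 8" "\<delta> * (m' * C1) \<le> k / 16"
  proof -
    show "\<delta> > 0" "\<delta> \<le> 1" "\<delta> \<le> d / K" using d K(1) k(1) S m'C1 by (auto simp: \<delta>_def)
    have cancel: "k / (q * y) * y = k / q" if "y > 0" for y q :: real
      using that by simp
    have "\<delta> * (S + 1) \<le> k / (8 * (S + 1)) * (S + 1)" using S by (intro mult_right_mono) (auto simp: \<delta>_def)
    also have "\<dots> = k / 8" using S by (intro cancel) simp
    finally show "\<delta> * S \<le> k / 8" using \<open>\<delta> > 0\<close> by (simp add: distrib_left)
    have "\<delta> * (m' * C1 + 1) \<le> k / (16 * (m' * C1 + 1)) * (m' * C1 + 1)"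
      using m'C1 by (intro mult_right_mono) (auto simp: \<delta>_def)
    also have "\<dots> = k / 16" using m'C1 by (intro cancel) simp
    finally show "\<delta> * (m' * C1) \<le> k / 16" using \<open>\<delta> > 0\<close> by (simp add: distrib_left)
  qed
  have key: "k / 4 * (nrm (\<lambda>x. u x - ug x))\<^sup>2 \<le> Q u - \<Lambda> \<and> Q u - \<Lambda> \<le> C1 * (nrm (\<lambda>x. u x - ug x))\<^sup>2 \<and>
      (\<forall>z \<mu>. X z \<longrightarrow> (\<forall>\<phi>. X \<phi> \<longrightarrow> ip z \<phi> = - A u \<phi> + \<mu> * ip (npow p u) \<phi>) \<longrightarrow> \<alpha> * (Q u - \<Lambda>) \<le> ip z z)"
    if Su: "Ssph c a b p u" and small: "nrm (\<lambda>x. u x - ug x) \<le> \<delta>" for u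
  proof -
    have u: "X u" "N u = 1" using Su by (auto simp: Ssph_iff)
    have Hu: "H1 a b u" by (rule Xsp_H1[OF u(1)])
    define v where "v x = u x - ug x" for x
    have Xv: "X v" using Xsp_lincomb[OF u(1) ug(1), of 1 "-1"] by (simp add: v_def[abs_def])
    have Hv: "H1 a b v" by (rule Xsp_H1[OF Xv])
    have uv: "(\<lambda>x. ug x + v x) = u" by (simp add: v_def)
    define n where "n = nrm v"
    have n: "0 \<le> n" "n \<le> \<delta>" "n \<le> 1"
      using small \<delta>(2) H1norm_nonneg by (auto simp: n_def v_def[abs_def])
    define m0 where "m0 = ip (npow p ug) v"
    define m1 where "m1 = ip (npow p u) v"
    define Wv where "Wv = weighted a b g v v"
    define a2 where "a2 = A v v"
    define E where "E = Q u - \<Lambda>"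
    \<comment> \<open>The Taylor remainder of the constraint; the values of \<open>N\<close> at
      \<open>u\<close> and \<open>ug\<close> are both 1 and cancel. Solved for \<open>m0\<close>, it
      shows that this formally linear term is of second order.\<close>
    define R1 where "R1 = - ((p + 1) * m0) - (p + 1) * p / 2 * Wv"
    define R2 where "R2 = m1 - m0 - p * Wv"
    have "\<bar>v x\<bar> \<le> d" if "x \<in> {a..b}" for x
    proof -
      have "\<bar>v x\<bar> \<le> K * n" unfolding n_def by (rule K(2)[OF Hv that])
      also have "\<dots> \<le> K * (d / K)" using n(2) \<delta>(3) K(1) by (intro mult_left_mono) auto
      finally show ?thesis using K(1) by simp
    qed
    with M(2) have "\<forall>x\<in>{a..b}. \<bar>ug x\<bar> \<le> M \<and> \<bar>v x\<bar> \<le> d" by blast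
    note T = tay[THEN spec, THEN spec, THEN mp, OF H1_continuous_on[OF Hg], THEN mp, OF H1_continuous_on[OF Hv],
        THEN mp, OF this, unfolded uv, folded g_def]
    have ipv: "ip v v \<le> n\<^sup>2" unfolding n_def by (rule L2inner_le_nrm)
    have R2: "\<bar>R2\<bar> \<le> \<epsilon> * n\<^sup>2"
    proof -
      have "\<bar>R2\<bar> \<le> \<epsilon> * ip v v" using T[THEN conjunct1] by (simp only: R2_def m0_def m1_def Wv_def)
      also have "\<dots> \<le> \<epsilon> * n\<^sup>2" using ipv \<epsilon>(1) by (intro mult_left_mono) auto
      finally show ?thesis .
    qed
    have R1: "\<bar>R1\<bar> \<le> (p + 1) * (\<epsilon> * n\<^sup>2)"
    proof -
      have "\<bar>R1\<bar> \<le> (p + 1) * \<epsilon> * ip v v"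
        using T[THEN conjunct2] by (simp add: R1_def m0_def Wv_def u ug)
      also have "\<dots> \<le> (p + 1) * \<epsilon> * n\<^sup>2" using ipv \<epsilon>(1) p by (intro mult_left_mono) auto
      finally show ?thesis by (simp only: mult.assoc)
    qed
    have n2: "\<epsilon> * n\<^sup>2 \<le> n\<^sup>2" using \<epsilon> by (simp add: mult_left_le_one_le)
    have Wb: "\<bar>Wv\<bar> \<le> w * n\<^sup>2"
      using weighted_bound[OF wt Hv Hv] by (simp add: Wv_def w_def n_def power2_eq_square)
    have a2b: "\<bar>a2\<bar> \<le> CA * n\<^sup>2"
      using CA(2)[OF Hv Hv] by (simp add: a2_def n_def power2_eq_square)
    have m0_eq: "m0 = - (p / 2 * Wv) - R1 / (p + 1)"
      using p by (simp add: R1_def field_simps)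
    define r1 where "r1 = R1 / (p + 1)"
    have r1: "\<bar>r1\<bar> \<le> \<epsilon> * n\<^sup>2"
      using R1 p by (simp add: r1_def pos_divide_le_eq mult.commute)
    have m0b: "\<bar>m0\<bar> \<le> m * n\<^sup>2"
    proof -
      have "\<bar>p / 2 * Wv\<bar> \<le> p / 2 * (w * n\<^sup>2)"
        unfolding abs_mult using Wb p by (intro mult_mono) auto
      moreover have "m * n\<^sup>2 = p / 2 * (w * n\<^sup>2) + n\<^sup>2" by (simp add: m_def algebra_simps)
      ultimately show ?thesis using m0_eq r1 n2 unfolding r1_def[symmetric] by linarith
    qed
    have m1b: "\<bar>m1\<bar> \<le> m' * n\<^sup>2"
    proof -
      have "\<bar>p * Wv\<bar> \<le> p * (w * n\<^sup>2)"
        unfolding abs_mult using Wb p by (intro mult_mono) auto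
      moreover have "m' * n\<^sup>2 = m * n\<^sup>2 + p * (w * n\<^sup>2) + n\<^sup>2" by (simp add: m'_def algebra_simps)
      moreover have "m1 = m0 + p * Wv + R2" by (simp add: R2_def)
      ultimately show ?thesis using m0b R2 n2 by linarith
    qed
    have Aug_v: "A ug v = \<Lambda> * m0" unfolding \<Lambda>_def m0_def by (rule ground_state_EL[OF gs Xv])
    have E_eq: "E = 2 * \<Lambda> * m0 + a2"
      using A.quad[OF Hg Hv, of 1 1] by (simp add: E_def Q_eq_A uv \<Lambda>_def a2_def Aug_v[unfolded \<Lambda>_def])
    have Eb: "\<bar>E\<bar> \<le> C1 * n\<^sup>2"
    proof -
      have "\<bar>2 * \<Lambda> * m0\<bar> \<le> 2 * L * (m * n\<^sup>2)"
        unfolding abs_mult using L m0b by (intro mult_mono) auto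
      moreover have "C1 * n\<^sup>2 = 2 * L * (m * n\<^sup>2) + CA * n\<^sup>2" by (simp add: C1_def algebra_simps)
      ultimately show ?thesis using E_eq a2b by linarith
    qed
    define B where "B = a2 - p * \<Lambda> * Wv"
    have EB: "E = B - 2 * (\<Lambda> * r1)"
      unfolding E_eq m0_eq B_def r1_def[symmetric] by (simp add: algebra_simps)
    have \<Lambda>\<epsilon>: "\<bar>\<Lambda> * r\<bar> \<le> k / 16 * n\<^sup>2" if "\<bar>r\<bar> \<le> \<epsilon> * n\<^sup>2" for r
    proof -
      have "\<bar>\<Lambda> * r\<bar> \<le> L * (\<epsilon> * n\<^sup>2)"
        unfolding abs_mult using L that by (intro mult_mono) auto
      also have "\<dots> = (L * \<epsilon>) * n\<^sup>2" by simp
      also have "\<dots> \<le> k / 16 * n\<^sup>2" using \<epsilon>(3) by (intro mult_right_mono) auto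
      finally show ?thesis .
    qed
    have n4: "n\<^sup>2 * n\<^sup>2 \<le> \<delta> * n\<^sup>2"
    proof -
      have "n\<^sup>2 \<le> n" using n(1,3) by (simp add: power2_eq_square mult_left_le_one_le)
      then have "n\<^sup>2 \<le> \<delta>" using n(2) by linarith
      then show ?thesis by (intro mult_right_mono) auto
    qed
    \<comment> \<open>Projecting \<open>v\<close> onto the tangent space costs only a term quadratic in \<open>m0 = O(n\<^sup>2)\<close>.\<close>
    have Blow: "3 * k / 8 * n\<^sup>2 \<le> B"
    proof -
      define \<xi> where "\<xi> = (\<lambda>x. 1 * v x + (- m0) * ug x)"
      have X\<xi>: "X \<xi>" unfolding \<xi>_def by (rule Xsp_lincomb[OF Xv ug(1)])
      have H\<xi>: "H1 a b \<xi>" by (rule Xsp_H1[OF X\<xi>])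
      have "ip (npow p ug) \<xi> = 0"
        unfolding \<xi>_def ip_npow_lincomb[OF Hg Hv Hg] ip_npow_self by (simp add: m0_def ug)
      then have nd\<xi>: "k * (nrm \<xi>)\<^sup>2 \<le> A \<xi> \<xi> - p * \<Lambda> * weighted a b g \<xi> \<xi>" by (rule k(2)[OF X\<xi>])
      have Wug: "weighted a b g v ug = m0"
      proof -
        have "weighted a b g v ug = ip (npow p ug) v"
          unfolding weighted_def by (rule L2inner_cong) (simp add: g_def npow_def)
        then show ?thesis by (simp add: m0_def)
      qed
      have Wgg: "weighted a b g ug ug = 1"
      proof -
        have "weighted a b g ug ug = ip (npow p ug) ug"
          unfolding weighted_def by (rule L2inner_cong) (simp add: g_def npow_def)
        then show ?thesis by (simp add: ip_npow_self ug)
      qed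
      have A\<xi>: "A \<xi> \<xi> = a2 - 2 * m0 * (\<Lambda> * m0) + m0\<^sup>2 * \<Lambda>"
        unfolding \<xi>_def A.quad[OF Hv Hg] a2_def
        using A.commute[OF Hv Hg] Aug_v by (simp add: \<Lambda>_def Q_eq_A)
      have W\<xi>: "weighted a b g \<xi> \<xi> = Wv - 2 * m0 * m0 + m0\<^sup>2"
        unfolding \<xi>_def W.quad[OF Hv Hg] Wug Wgg Wv_def by simp
      \<comment> \<open>The projection subtracts \<Lambda> m0^2 from the A part and m0^2 from the
        weighted part, which enters with factor -p \<Lambda>; the net effect is (p - 1) \<Lambda>
        m0^2.\<close>
      have 1: "B = (A \<xi> \<xi> - p * \<Lambda> * weighted a b g \<xi> \<xi>) - (p - 1) * \<Lambda> * m0\<^sup>2"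
        unfolding A\<xi> W\<xi> B_def by (simp add: power2_eq_square algebra_simps)
      have "v = (\<lambda>x. 1 * \<xi> x + m0 * ug x)" by (auto simp: \<xi>_def)
      then have "n \<le> nrm \<xi> + \<bar>m0\<bar> * G"
        using H1norm_lincomb_le[OF H\<xi> Hg, of 1 m0] by (simp add: n_def G_def)
      then have "n\<^sup>2 \<le> (nrm \<xi> + \<bar>m0\<bar> * G)\<^sup>2" using n(1) by (intro power_mono)
      also have "\<dots> \<le> 2 * (nrm \<xi>)\<^sup>2 + 2 * (\<bar>m0\<bar> * G)\<^sup>2"
        using sum_squares_bound[of "nrm \<xi>" "\<bar>m0\<bar> * G"] by (simp add: power2_sum)
      also have "(\<bar>m0\<bar> * G)\<^sup>2 = m0\<^sup>2 * G\<^sup>2" by (simp add: power_mult_distrib)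
      finally have "k * (n\<^sup>2 / 2 - m0\<^sup>2 * G\<^sup>2) \<le> k * (nrm \<xi>)\<^sup>2"
        using k(1) by (intro mult_left_mono) auto
      then have 2: "k / 2 * n\<^sup>2 - k * G\<^sup>2 * m0\<^sup>2 \<le> k * (nrm \<xi>)\<^sup>2" by (simp add: algebra_simps)
      have 3: "(p - 1) * \<Lambda> * m0\<^sup>2 \<le> (p - 1) * L * m0\<^sup>2"
        using p L by (intro mult_right_mono mult_left_mono) auto
      have "m0\<^sup>2 \<le> (m * n\<^sup>2)\<^sup>2" using power_mono[OF m0b, of 2] by simp
      then have "(k * G\<^sup>2 + (p - 1) * L) * m0\<^sup>2 \<le> (k * G\<^sup>2 + (p - 1) * L) * (m * n\<^sup>2)\<^sup>2"
        using k(1) p L by (intro mult_left_mono) auto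
      also have "\<dots> = S * (n\<^sup>2 * n\<^sup>2)" by (simp add: S_def power_mult_distrib power2_eq_square)
      also have "\<dots> \<le> S * (\<delta> * n\<^sup>2)" using S n4 by (intro mult_left_mono)
      also have "\<dots> = (\<delta> * S) * n\<^sup>2" by simp
      also have "\<dots> \<le> k / 8 * n\<^sup>2" using \<delta>(4) by (intro mult_right_mono) auto
      finally have 4: "k * G\<^sup>2 * m0\<^sup>2 + (p - 1) * L * m0\<^sup>2 \<le> k / 8 * n\<^sup>2" by (simp only: distrib_right)
      have "3 * k / 8 * n\<^sup>2 = k / 2 * n\<^sup>2 - k / 8 * n\<^sup>2" by (simp add: algebra_simps)
      then show ?thesis using 1 2 3 4 nd\<xi> by linarith
    qed
    have Elow: "k / 4 * n\<^sup>2 \<le> E"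
    proof -
      have "3 * k / 8 * n\<^sup>2 = k / 4 * n\<^sup>2 + 2 * (k / 16 * n\<^sup>2)" by simp
      then show ?thesis using Blow EB \<Lambda>\<epsilon>[OF r1] by linarith
    qed
    define \<phi> where "\<phi> = (\<lambda>x. 1 * v x + (- m1) * u x)"
    have X\<phi>: "X \<phi>" unfolding \<phi>_def by (rule Xsp_lincomb[OF Xv u(1)])
    have H\<phi>: "H1 a b \<phi>" by (rule Xsp_H1[OF X\<phi>])
    have ip\<phi>: "ip (npow p u) \<phi> = 0"
      unfolding \<phi>_def ip_npow_lincomb[OF Hu Hv Hu] ip_npow_self by (simp add: m1_def u)
    \<comment> \<open>Write Q(u) = \<Lambda> + E. The first-order terms combine to \<Lambda> (m0 -
      m1), and m1 - m0 is p Wv + R2: this supplies the missing part of B.\<close>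
    have A\<phi>_eq: "A u \<phi> = B - \<Lambda> * R2 - m1 * E"
    proof -
      have "A u v = A ug v + A v v" using A.left[OF Hg Hv Hv, of 1 1] by (simp add: uv)
      then have "A u \<phi> = \<Lambda> * m0 + a2 - m1 * Q u"
        unfolding \<phi>_def A.right[OF Hv Hu Hu] by (simp add: Aug_v a2_def Q_eq_A)
      then show ?thesis by (simp add: B_def R2_def E_def algebra_simps)
    qed
    have A\<phi>: "k / 4 * n\<^sup>2 \<le> A u \<phi>"
    proof -
      have "\<bar>m1 * E\<bar> \<le> (m' * n\<^sup>2) * (C1 * n\<^sup>2)"
        unfolding abs_mult using m1b Eb m' by (intro mult_mono) auto
      also have "\<dots> = (m' * C1) * (n\<^sup>2 * n\<^sup>2)" by simp
      also have "\<dots> \<le> (m' * C1) * (\<delta> * n\<^sup>2)" using n4 m'C1 by (intro mult_left_mono)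
      also have "\<dots> = (\<delta> * (m' * C1)) * n\<^sup>2" by simp
      also have "\<dots> \<le> k / 16 * n\<^sup>2" using \<delta>(5) by (intro mult_right_mono) auto
      finally have "\<bar>m1 * E\<bar> \<le> k / 16 * n\<^sup>2" .
      moreover have "3 * k / 8 * n\<^sup>2 = k / 4 * n\<^sup>2 + 2 * (k / 16 * n\<^sup>2)" by simp
      ultimately show ?thesis using A\<phi>_eq Blow \<Lambda>\<epsilon>[OF R2] by linarith
    qed
    have \<phi>n: "nrm \<phi> \<le> P * n"
    proof -
      have "nrm u \<le> G + n"
        using H1norm_lincomb_le[OF Hg Hv, of 1 1] by (simp add: uv G_def n_def)
      then have nu: "nrm u \<le> G + 1" using n(3) by simp
      have "nrm \<phi> \<le> n + \<bar>m1\<bar> * nrm u"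
        using H1norm_lincomb_le[OF Hv Hu, of 1 "- m1"] by (simp add: \<phi>_def n_def)
      also have "\<bar>m1\<bar> * nrm u \<le> (m' * n) * (G + 1)"
      proof (intro mult_mono nu)
        have "m' * n\<^sup>2 \<le> m' * n"
          using n(1,3) m' by (intro mult_left_mono) (auto simp: power2_eq_square mult_left_le_one_le)
        with m1b show "\<bar>m1\<bar> \<le> m' * n" by linarith
      qed (use m' n in \<open>auto simp: H1norm_nonneg\<close>)
      finally show ?thesis by (simp add: P_def algebra_simps)
    qed
    have "\<alpha> * E \<le> ip z z" if z: "X z" and eq: "\<forall>\<phi>. X \<phi> \<longrightarrow> ip z \<phi> = - A u \<phi> + \<mu> * ip (npow p u) \<phi>" for z \<mu>
    proof -
      define \<zeta> where "\<zeta> = sqrt (ip z z)"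
      have \<zeta>: "\<zeta> \<ge> 0" "\<zeta>\<^sup>2 = ip z z" by (auto simp: \<zeta>_def L2inner_nonneg)
      have "A u \<phi> = - ip z \<phi>" using eq X\<phi> ip\<phi> by simp
      then have "A u \<phi> \<le> \<bar>ip z \<phi>\<bar>" by simp
      also have "\<dots> \<le> \<zeta> * sqrt (ip \<phi> \<phi>)"
        unfolding \<zeta>_def by (rule L2inner_Cauchy_Schwarz[OF H1_L2[OF Xsp_H1[OF z]] H1_L2[OF H\<phi>]])
      also have "\<dots> \<le> \<zeta> * (P * n)"
        using order_trans[OF sqrt_L2inner_le_H1norm \<phi>n] \<zeta>(1) by (intro mult_left_mono)
      finally have "k / 4 * n\<^sup>2 \<le> \<zeta> * (P * n)" using A\<phi> by linarith
      then have "n * (k / 4 * n) \<le> n * (P * \<zeta>)" by (simp add: power2_eq_square mult_ac)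
      then have "k / 4 * n \<le> P * \<zeta>"
        using n(1) P \<zeta>(1) by (cases "n = 0") auto
      then have "(k / 4 * n)\<^sup>2 \<le> (P * \<zeta>)\<^sup>2" using k(1) n(1) by (intro power_mono) auto
      then have "(k / 4)\<^sup>2 * n\<^sup>2 \<le> P\<^sup>2 * ip z z" by (simp only: power_mult_distrib \<zeta>(2))
      then have "(k / 4)\<^sup>2 / P\<^sup>2 * n\<^sup>2 \<le> ip z z" using P by (simp add: pos_divide_le_eq mult.commute)
      moreover have "\<alpha> * E \<le> \<alpha> * (C1 * n\<^sup>2)" using Eb \<alpha> by (intro mult_left_mono) auto
      moreover have "\<alpha> * (C1 * n\<^sup>2) = (k / 4)\<^sup>2 / P\<^sup>2 * n\<^sup>2" using C1 by (simp add: \<alpha>_def)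
      ultimately show ?thesis by linarith
    qed
    moreover have "nrm (\<lambda>x. u x - ug x) = n" by (simp add: n_def v_def[abs_def])
    ultimately show ?thesis using Elow Eb unfolding E_def by auto
  qed
  have "k / 4 > 0" using k(1) by simp
  with \<delta>(1) C1 \<alpha> key show ?thesis
    unfolding \<Lambda>_def by blast
qed

section \<open>The normalized gradient flow\<close>

text \<open>If \<open>u\<close> vanishes, \<^const>\<open>lam\<close> has the junk value \<open>0\<close> and the claim holds by Cauchy--Schwarz.\<close>

lemma flow_npow_orthogonal:
  assumes u: "X u" and z: "X z"
    and eq: "\<And>\<phi>. X \<phi> \<Longrightarrow> ip z \<phi> = - A u \<phi> + lam a b V \<omega> p u * ip (npow p u) \<phi>"
  shows "ip (npow p u) z = 0"
proof (cases "ip (npow p u) (npow p u) = 0")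
  case True
  have "\<bar>ip (npow p u) z\<bar> \<le> sqrt (ip (npow p u) (npow p u)) * sqrt (ip z z)"
    by (rule L2inner_Cauchy_Schwarz[OF L2_npow[OF Xsp_H1[OF u]] H1_L2[OF Xsp_H1[OF z]]])
  with True show ?thesis by simp
next
  case False
  have Xn: "X (npow p u)" using ab by (intro Xsp_npow[OF _ p u]) simp
  have "lam a b V \<omega> p u * ip (npow p u) (npow p u) = A u (npow p u)"
    using False by (simp add: lam_def ip_npow_npow)
  with eq[OF Xn] have "ip z (npow p u) = 0" by simp
  then show ?thesis by (simp only: L2inner_commute)
qed

text \<open>The velocity lies in X and may be tested against itself; by its orthogonality to the
  nonlinearity the multiplier term drops out of the energy derivative, and the derivative of the
  constraint vanishes.\<close>

lemma flow_invariants: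
  assumes fl: "flow_sol c a b V \<omega> p u"
  shows "\<exists>ut. \<forall>t>0. X (ut t) \<and>
      (\<forall>\<phi>. X \<phi> \<longrightarrow> ip (ut t) \<phi> = - A (u t) \<phi> + lam a b V \<omega> p (u t) * ip (npow p (u t)) \<phi>) \<and>
      ((\<lambda>s. Q (u s)) has_real_derivative - 2 * ip (ut t) (ut t)) (at t)"
    and "continuous_on {0..} (\<lambda>s. Q (u s))"
    and "\<forall>t\<ge>0. N (u t) = N (u 0)"
proof -
  have X: "\<And>t. t \<ge> 0 \<Longrightarrow> X (u t)"
    and cont: "\<And>t. t \<ge> 0 \<Longrightarrow> ((\<lambda>s. nrm (\<lambda>x. u s x - u t x)) \<longlongrightarrow> 0) (at t within {0..})"
    using fl unfolding flow_sol_def by blast+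
  obtain ut where ut: "\<And>t. t > 0 \<Longrightarrow> X (ut t)"
      "\<And>t. t > 0 \<Longrightarrow> ((\<lambda>s. nrm (\<lambda>x. (u s x - u t x) / (s - t) - ut t x)) \<longlongrightarrow> 0) (at t)"
      "\<And>t \<phi>. t > 0 \<Longrightarrow> X \<phi> \<Longrightarrow> ip (ut t) \<phi> = - A (u t) \<phi> + lam a b V \<omega> p (u t) * ip (npow p (u t)) \<phi>"
    using fl unfolding flow_sol_def by blast
  have H: "H1 a b (u t)" if "t \<ge> 0" for t by (rule Xsp_H1[OF X[OF that]])
  have orth: "ip (npow p (u t)) (ut t) = 0" if t: "t > 0" for t
    by (rule flow_npow_orthogonal[OF X ut(1)[OF t] ut(3)[OF t]]) (use t in auto)
  have cont_fun: "continuous_on {0..} (\<lambda>s. \<Phi> (u s))"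
    if "\<And>v. H1 a b v \<Longrightarrow> H1_diffable a b \<Phi> v (\<l> v)" for \<Phi> \<l>
    unfolding continuous_on_def
  proof
    fix t :: real assume t: "t \<in> {0..}"
    then have t0: "t \<ge> 0" by simp
    show "((\<lambda>s. \<Phi> (u s)) \<longlongrightarrow> \<Phi> (u t)) (at t within {0..})"
      by (rule H1_diffable_continuous[where u = u and t = t, OF that[OF H[OF t0]] _ t cont[OF t0]]) (simp add: H)
  qed
  have dQ: "((\<lambda>s. Q (u s)) has_real_derivative - 2 * ip (ut t) (ut t)) (at t)" if t: "t > 0" for t
  proof -
    have "((\<lambda>s. Q (u s)) has_real_derivative 2 * A (u t) (ut t)) (at t)"
      by (rule H1_diffable_chain[where u = u and t = t and \<l> = "\<lambda>h. 2 * A (u t) h",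
            OF Q_diffable[OF H[OF less_imp_le[OF t]]] H[OF less_imp_le] t Xsp_H1[OF ut(1)[OF t]] ut(2)[OF t]])
    moreover have "A (u t) (ut t) = - ip (ut t) (ut t)"
      using ut(3)[OF t ut(1)[OF t]] orth[OF t] by simp
    ultimately show ?thesis by simp
  qed
  have dN: "((\<lambda>s. N (u s)) has_real_derivative 0) (at t)" if t: "t > 0" for t
  proof -
    have "((\<lambda>s. N (u s)) has_real_derivative (p + 1) * ip (npow p (u t)) (ut t)) (at t)"
      by (rule H1_diffable_chain[where u = u and t = t and \<l> = "\<lambda>h. (p + 1) * ip (npow p (u t)) h",
            OF N_diffable[OF H[OF less_imp_le[OF t]]] H[OF less_imp_le] t Xsp_H1[OF ut(1)[OF t]] ut(2)[OF t]])
    then show ?thesis by (simp add: orth[OF t])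
  qed
  have N: "N (u t) = N (u 0)" if t: "t \<ge> 0" for t
  proof (cases "t = 0")
    case False
    then have "0 < t" using t by simp
    \<comment> \<open>The equation holds only for positive times; time 0 is reached through
      continuity at the end point.\<close>
    then show ?thesis
    proof (rule DERIV_isconst_end)
      show "continuous_on {0..t} (\<lambda>s. N (u s))"
        by (rule continuous_on_subset[OF cont_fun[OF N_diffable]]) auto
    qed (use dN in auto)
  qed simp
  show "\<exists>ut. \<forall>t>0. X (ut t) \<and>
      (\<forall>\<phi>. X \<phi> \<longrightarrow> ip (ut t) \<phi> = - A (u t) \<phi> + lam a b V \<omega> p (u t) * ip (npow p (u t)) \<phi>) \<and>
      ((\<lambda>s. Q (u s)) has_real_derivative - 2 * ip (ut t) (ut t)) (at t)"
    by (intro exI[of _ ut] allI impI conjI ut dQ)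
  show "continuous_on {0..} (\<lambda>s. Q (u s))" by (rule cont_fun[OF Q_diffable])
  show "\<forall>t\<ge>0. N (u t) = N (u 0)" by (intro allI impI N)
qed

text \<open>The conditions on \<open>\<delta>0\<close> set up an energy barrier: C1 \<delta>0^2
  bounds the initial energy gap, while c1 \<delta>^2 is a lower bound for the gap at distance
  \<delta> from \<open>ug\<close>.\<close>

lemma flow_converges:
  assumes fl: "flow_sol c a b V \<omega> p u" and S0: "Ssph c a b p (u 0)"
    and pos: "\<delta> > 0" "c1 > 0" "C1 > 0" "\<alpha> > 0"
    and est: "\<forall>u. Ssph c a b p u \<longrightarrow> nrm (\<lambda>x. u x - ug x) \<le> \<delta> \<longrightarrow>
      c1 * (nrm (\<lambda>x. u x - ug x))\<^sup>2 \<le> Q u - Q ug \<and>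
      Q u - Q ug \<le> C1 * (nrm (\<lambda>x. u x - ug x))\<^sup>2 \<and>
      (\<forall>z \<mu>. X z \<longrightarrow> (\<forall>\<phi>. X \<phi> \<longrightarrow> ip z \<phi> = - A u \<phi> + \<mu> * ip (npow p u) \<phi>) \<longrightarrow>
        \<alpha> * (Q u - Q ug) \<le> ip z z)"
    and ug: "X ug"
    and d0: "nrm (\<lambda>x. u 0 x - ug x) \<le> \<delta>0" "\<delta>0 < \<delta>" "C1 * \<delta>0\<^sup>2 < c1 * \<delta>\<^sup>2"
  shows "\<exists>C>0. \<exists>\<beta>>0. \<forall>t>0. nrm (\<lambda>x. u t x - ug x) \<le> C * exp (- \<beta> * t)"
proof -
  obtain ut where ut': "\<forall>t>0. X (ut t) \<and>
      (\<forall>\<phi>. X \<phi> \<longrightarrow> ip (ut t) \<phi> = - A (u t) \<phi> + lam a b V \<omega> p (u t) * ip (npow p (u t)) \<phi>) \<and>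
      ((\<lambda>s. Q (u s)) has_real_derivative - 2 * ip (ut t) (ut t)) (at t)"
    using flow_invariants(1)[OF fl] by blast
  note ut = ut'[rule_format, THEN conjunct1] ut'[rule_format, THEN conjunct2, THEN conjunct1, rule_format]
    and dQ = ut'[rule_format, THEN conjunct2, THEN conjunct2]
  note cQ = flow_invariants(2)[OF fl] and N = flow_invariants(3)[OF fl, rule_format]
  have X: "\<And>t. t \<ge> 0 \<Longrightarrow> X (u t)"
    and cont: "\<And>t. t \<ge> 0 \<Longrightarrow> ((\<lambda>s. nrm (\<lambda>x. u s x - u t x)) \<longlongrightarrow> 0) (at t within {0..})"
    using fl unfolding flow_sol_def by blast+
  have S: "Ssph c a b p (u t)" if "t \<ge> 0" for t
    using S0 N[OF that] X[OF that] by (simp add: Ssph_iff)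
  define n where "n t = nrm (\<lambda>x. u t x - ug x)" for t
  define E where "E t = Q (u t) - Q ug" for t
  have n0: "n t \<ge> 0" for t by (simp add: n_def H1norm_nonneg)
  have H: "H1 a b (u t)" if "t \<ge> 0" for t by (rule Xsp_H1[OF X[OF that]])
  have Hd: "H1 a b (\<lambda>x. u t x - ug x)" if "t \<ge> 0" for t
    by (rule H1_diff[OF H[OF that] Xsp_H1[OF ug]])
  have cE: "continuous_on {0..} E" unfolding E_def by (intro continuous_intros cQ)
  have dE: "(E has_real_derivative - 2 * ip (ut t) (ut t)) (at t)" if "t > 0" for t
    unfolding E_def using DERIV_diff[OF dQ[OF that] DERIV_const[of "Q ug"]] by simp
  have cn: "continuous_on {0..} n"
    unfolding continuous_on_def
  proof
    fix t :: real assume t: "t \<in> {0..}"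
    then have t0: "t \<ge> 0" by simp
    have "((\<lambda>s. n s - n t) \<longlongrightarrow> 0) (at t within {0..})"
    proof (rule Lim_null_comparison[OF _ cont[OF t0]])
      have "\<forall>\<^sub>F s in at t within {0..}. s \<ge> 0" by (simp add: eventually_at_filter)
      then show "\<forall>\<^sub>F s in at t within {0..}. norm (n s - n t) \<le> nrm (\<lambda>x. u s x - u t x)"
      proof eventually_elim
        case (elim s)
        have "n s \<le> n t + nrm (\<lambda>x. u s x - u t x)"
          using H1norm_diff_le[OF Hd[OF elim] Hd[OF t0]] by (simp add: n_def)
        moreover have "n t \<le> n s + nrm (\<lambda>x. u t x - u s x)"
          using H1norm_diff_le[OF Hd[OF t0] Hd[OF elim]] by (simp add: n_def)
        moreover have "nrm (\<lambda>x. u t x - u s x) = nrm (\<lambda>x. u s x - u t x)"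
          using H1norm_scale[OF H1_diff[OF H[OF elim] H[OF t0]], of "-1"] by simp
        ultimately show ?case by simp
      qed
    qed
    then show "(n \<longlongrightarrow> n t) (at t within {0..})" by (simp add: LIM_zero_iff)
  qed
  have Edec: "E t \<le> E 0" if t: "t \<ge> 0" for t
  proof (rule DERIV_nonpos_imp_decreasing_open[OF t])
    show "continuous_on {0..t} E" by (rule continuous_on_subset[OF cE]) auto
    show "\<exists>y. (E has_real_derivative y) (at s) \<and> y \<le> 0" if "0 < s" "s < t" for s
      using dE[OF that(1)] L2inner_nonneg[of a b "ut s"] by (intro exI conjI) auto
  qed
  have n0\<delta>: "n 0 \<le> \<delta>0" using d0(1) by (simp add: n_def)
  have E0: "E 0 < c1 * \<delta>\<^sup>2"
  proof -
    have "E 0 \<le> C1 * (n 0)\<^sup>2" unfolding E_def n_def using est[rule_format, OF S0] d0 by simp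
    also have "\<dots> \<le> C1 * \<delta>0\<^sup>2" using pos(3) n0[of 0] n0\<delta> by (intro mult_left_mono power_mono) auto
    finally show ?thesis using d0(3) by simp
  qed
  \<comment> \<open>Leaving the ball would require crossing the sphere of radius \<open>\<delta>\<close>, where the energy exceeds its initial value.\<close>
  have trapped: "n t \<le> \<delta>" if t: "t \<ge> 0" for t
  proof (rule ccontr)
    assume "\<not> n t \<le> \<delta>"
    moreover have "n 0 \<le> \<delta>" using n0\<delta> d0(2) by simp
    moreover have "continuous_on {0..t} n" by (rule continuous_on_subset[OF cn]) auto
    ultimately obtain s where s: "0 \<le> s" "n s = \<delta>" using IVT'[of n 0 \<delta> t] t by auto
    have "c1 * (n s)\<^sup>2 \<le> E s" 
      using est[rule_format, OF S[OF s(1)]] s(2) by (simp add: E_def n_def)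
    then show False using Edec[OF s(1)] E0 s(2) by simp
  qed
  \<comment> \<open>Gronwall by an integrating factor: the gradient inequality gives E' \<le> -2
    \<alpha> E, so F cannot increase.\<close>
  define F where "F t = E t * exp (2 * \<alpha> * t)" for t
  have Fdec: "F t \<le> F 0" if t: "t \<ge> 0" for t
  proof (rule DERIV_nonpos_imp_decreasing_open[OF t])
    show "continuous_on {0..t} F"
      unfolding F_def by (intro continuous_intros continuous_on_subset[OF cE]) auto
    fix s assume s: "0 < s" "s < t"
    let ?D = "- 2 * ip (ut s) (ut s) * exp (2 * \<alpha> * s) + exp (2 * \<alpha> * s) * (2 * \<alpha>) * E s"
    have "((\<lambda>t. exp (2 * \<alpha> * t)) has_real_derivative exp (2 * \<alpha> * s) * (2 * \<alpha>)) (at s)"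
      by (auto intro!: derivative_eq_intros)
    then have D: "(F has_real_derivative ?D) (at s)"
      unfolding F_def by (rule DERIV_mult[OF dE[OF s(1)]])
    have "\<alpha> * E s \<le> ip (ut s) (ut s)"
    proof -
      have "nrm (\<lambda>x. u s x - ug x) \<le> \<delta>" using trapped[of s] s by (simp add: n_def)
      from est[THEN spec, THEN mp, OF S, THEN mp, OF _ this] s
      have "\<forall>z \<mu>. X z \<longrightarrow> (\<forall>\<phi>. X \<phi> \<longrightarrow> ip z \<phi> = - A (u s) \<phi> + \<mu> * ip (npow p (u s)) \<phi>) \<longrightarrow>
          \<alpha> * (Q (u s) - Q ug) \<le> ip z z" by simp
      with ut[OF s(1)] show ?thesis unfolding E_def by blast
    qed
    then have "2 * exp (2 * \<alpha> * s) * (\<alpha> * E s) \<le> 2 * exp (2 * \<alpha> * s) * ip (ut s) (ut s)"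
      by (intro mult_left_mono) auto
    then have "?D \<le> 0" by (simp add: mult_ac)
    with D show "\<exists>y. (F has_real_derivative y) (at s) \<and> y \<le> 0" by blast
  qed
  \<comment> \<open>The added 1 keeps \<open>C\<close> positive when the initial gap is 0. The norm
    decays at rate \<alpha>, half the rate of the energy, because the energy controls its
    square.\<close>
  define C where "C = sqrt (\<bar>E 0\<bar> / c1) + 1"
  have C: "C > 0" using pos(2) by (simp add: C_def add_nonneg_pos)
  have "n t \<le> C * exp (- \<alpha> * t)" if t: "t > 0" for t
  proof -
    have "c1 * (n t)\<^sup>2 \<le> E t" 
      using est[rule_format, OF S[of t]] t trapped[of t] by (simp add: E_def n_def)
    moreover have "E t * exp (2 * \<alpha> * t) \<le> E 0" using Fdec[of t] t by (simp add: F_def)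
    then have "E t \<le> E 0 * exp (- (2 * \<alpha> * t))"
      by (simp add: exp_minus pos_le_divide_eq divide_inverse[symmetric])
    moreover have "E 0 * exp (- (2 * \<alpha> * t)) \<le> \<bar>E 0\<bar> * exp (- (2 * \<alpha> * t))"
      by (intro mult_right_mono) auto
    ultimately have "c1 * (n t)\<^sup>2 \<le> \<bar>E 0\<bar> * exp (- (2 * \<alpha> * t))" by linarith
    then have "(n t)\<^sup>2 \<le> \<bar>E 0\<bar> * exp (- (2 * \<alpha> * t)) / c1"
      using pos(2) by (simp add: pos_le_divide_eq mult.commute)
    also have "\<dots> = (sqrt (\<bar>E 0\<bar> / c1) * exp (- \<alpha> * t))\<^sup>2"
      using pos(2) by (simp add: power_mult_distrib exp_double[symmetric] mult.assoc)
    finally have "n t \<le> sqrt (\<bar>E 0\<bar> / c1) * exp (- \<alpha> * t)"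
      by (rule power2_le_imp_le) (use pos(2) in simp)
    also have "\<dots> \<le> C * exp (- \<alpha> * t)" by (intro mult_right_mono) (auto simp: C_def)
    finally show ?thesis .
  qed
  then show ?thesis using C pos(4) unfolding n_def by blast
qed

end

theorem mainTheorem20:
  fixes c :: bc and a b p \<omega> :: real and V ug :: "real \<Rightarrow> real"
  assumes ab: "a < b"
    and A1: "1 < p" "V \<in> borel_measurable lborel"
        "\<exists>M. AE x in lborel. x \<in> {a..b} \<longrightarrow> 0 \<le> V x \<and> V x \<le> M"
    and A2: "\<omega> > - lambda0 c a b V"
    and gs: "ground_state c a b V \<omega> p ug"
    and nd: "ND c a b V \<omega> p ug"
    and R_ex: "\<forall>u0. Ssph c a b p u0 \<longrightarrow>
                 (\<exists>u. flow_sol c a b V \<omega> p u \<and> (\<forall>x\<in>{a..b}. u 0 x = u0 x))"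
    and R_uniq: "\<forall>u v. flow_sol c a b V \<omega> p u \<and> flow_sol c a b V \<omega> p v \<and>
                   (\<forall>x\<in>{a..b}. u 0 x = v 0 x) \<longrightarrow> (\<forall>t\<ge>0. \<forall>x\<in>{a..b}. u t x = v t x)"
  shows "\<exists>\<delta>0>0. \<forall>u0. Ssph c a b p u0 \<and> H1norm a b (\<lambda>x. u0 x - ug x) \<le> \<delta>0 \<longrightarrow>
           (\<forall>u. flow_sol c a b V \<omega> p u \<and> (\<forall>x\<in>{a..b}. u 0 x = u0 x) \<longrightarrow>
              (\<exists>C>0. \<exists>\<alpha>>0. \<forall>t>0. H1norm a b (\<lambda>x. u t x - ug x) \<le> C * exp (- \<alpha> * t)))"
proof -
  obtain M where "AE x in lborel. x \<in> {a..b} \<longrightarrow> 0 \<le> V x \<and> V x \<le> M" using A1(3) by blast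
  then have "AE x\<in>{a..b} in lborel. \<bar>V x\<bar> \<le> M" by eventually_elim auto
  then interpret gradient_flow_setting c a b p \<omega> V
    using ab A1 by unfold_locales auto
  have ug: "X ug" using gs by (simp add: ground_state_def Ssph_iff)
  obtain \<delta> c1 C1 \<alpha> where pos: "\<delta> > 0" "c1 > 0" "C1 > 0" "\<alpha> > 0"
    and est: "\<forall>u. Ssph c a b p u \<longrightarrow> nrm (\<lambda>x. u x - ug x) \<le> \<delta> \<longrightarrow>
      c1 * (nrm (\<lambda>x. u x - ug x))\<^sup>2 \<le> Q u - Q ug \<and>
      Q u - Q ug \<le> C1 * (nrm (\<lambda>x. u x - ug x))\<^sup>2 \<and>
      (\<forall>z \<mu>. X z \<longrightarrow> (\<forall>\<phi>. X \<phi> \<longrightarrow> ip z \<phi> = - A u \<phi> + \<mu> * ip (npow p u) \<phi>) \<longrightarrow>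
        \<alpha> * (Q u - Q ug) \<le> ip z z)"
    using ground_state_local_estimates[OF gs nd] by blast
  \<comment> \<open>The first entry gives \<delta>0 < \<delta>; the second gives C1 \<delta>0^2
    \<le> c1 \<delta>^2 / 2, which is below the barrier.\<close>
  define \<delta>0 where "\<delta>0 = min (\<delta> / 2) (\<delta> * sqrt (c1 / (2 * C1)))"
  have \<delta>0: "\<delta>0 > 0" "\<delta>0 < \<delta>" using pos by (auto simp: \<delta>0_def)
  have "\<delta>0\<^sup>2 \<le> (\<delta> * sqrt (c1 / (2 * C1)))\<^sup>2"
    using \<delta>0(1) by (intro power_mono) (auto simp: \<delta>0_def)
  also have "\<dots> = \<delta>\<^sup>2 * (c1 / (2 * C1))" using pos by (simp add: power_mult_distrib)
  finally have "C1 * \<delta>0\<^sup>2 \<le> C1 * (\<delta>\<^sup>2 * (c1 / (2 * C1)))" using pos(3) by (intro mult_left_mono) auto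
  also have "\<dots> = c1 * \<delta>\<^sup>2 / 2" using pos(3) by simp
  also have "\<dots> < c1 * \<delta>\<^sup>2" using pos by simp
  finally have small: "C1 * \<delta>0\<^sup>2 < c1 * \<delta>\<^sup>2" .
  show ?thesis
  proof (rule exI[of _ \<delta>0], intro conjI allI impI \<delta>0(1), elim conjE)
    fix u0 u
    assume u0: "Ssph c a b p u0" "nrm (\<lambda>x. u0 x - ug x) \<le> \<delta>0"
      and fl: "flow_sol c a b V \<omega> p u" and eq: "\<forall>x\<in>{a..b}. u 0 x = u0 x"
    \<comment> \<open>The solution takes its initial value on the interval only, so closeness and
      the constraint must be carried over from \<open>u0\<close>.\<close>
    have "nrm (\<lambda>x. u 0 x - ug x) = nrm (\<lambda>x. u0 x - ug x)"
      by (rule H1norm_cong) (use ab eq in auto)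
    moreover have "N (u 0) = N u0"
      unfolding pint_def by (rule set_lebesgue_integral_cong) (use eq in auto)
    moreover have "X (u 0)" using fl by (simp add: flow_sol_def)
    ultimately show "\<exists>C>0. \<exists>\<alpha>>0. \<forall>t>0. nrm (\<lambda>x. u t x - ug x) \<le> C * exp (- \<alpha> * t)"
      using u0 by (intro flow_converges[OF fl _ pos est ug _ \<delta>0(2) small]) (auto simp: Ssph_iff)
  qed
qed

end
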